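(* Let $\mathbf{\Phi}$ be an irreducible and positive recurrent discrete-time Markov chain on a countable state space $E$ with transition matrix $P$ and invariant probability vector $\boldsymbol\pi$. Let $A$ be a finite non-empty subset of $E$, $B=E\setminus A$, and let $\widetilde X=\begin{bmatrix}\widetilde X_A\\ \widetilde X_B\end{bmatrix}$ be the matrix given by $$\widetilde{X}_{A}=\left(I-P^{(A)}\right)^{\#}\left(\left[I,\; P_{AB}\widehat{P}_{BB}\right]-\left(\boldsymbol e+P_{AB}\widehat{P}_{BB}\boldsymbol e\right)\boldsymbol\pi^T\right),$$ $$\widetilde{X}_{B}=\widehat{P}_{BB}P_{BA}\widetilde{X}_A+\left[O,\;\widehat{P}_{BB}\right]-\widehat{P}_{BB}\boldsymbol e\,\boldsymbol \pi^T.$$ Then, for any fixed state $\alpha\in A$, the matrix $K=(K(i,j))_{i,j\in E}$ defined by $$K(i,j)=\mathbb{E}_{i}\bigg[\sum_{k=0}^{\tau_{\alpha}-1}\big(\mathbb{I}(\Phi_k=j)-\pi(j)\big)\bigg],\qquad i,j\in E,$$ satisfies $$K=\widetilde{X}-\boldsymbol{e}\boldsymbol{\beta}^T,$$ where $\beta(j)=\widetilde{X}(\alpha,j)$ for every $j\in E$.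
   Context: $\mathbf{\Phi}=\{\Phi_k,k\ge 0\}$ is a discrete-time Markov chain on $E$ with transition matrix $P=(P(i,j))_{i,j\in E}$; $\boldsymbol\pi$ is its unique invariant probability vector ($\boldsymbol\pi^TP=\boldsymbol\pi^T$, $\boldsymbol\pi^T\boldsymbol e=1$). $\boldsymbol e$ is the column vector of ones, $I$ the identity matrix, $O$ the zero matrix, each of the size appropriate to the place where it occurs. $P_{A_1A_2}=(P(i,j))_{i\in A_1,j\in A_2}$ denotes blocks of $P$. For a matrix $X=(X(i,j))_{i,j\in E}$, $X_A$ and $X_B$ denote the rows of $X$ indexed by $A$ and by $B$ (with all columns in $E$); in a bracket $[\,\cdot\,,\,\cdot\,]$ the first block consists of the columns indexed by $A$ and the second of the columns indexed by $B$. $\widehat P_{BB}:=\sum_{k=0}^\infty P_{BB}^k$ (finite entrywise), and $P^{(A)}:=P_{AA}+P_{AB}\widehat P_{BB}P_{BA}$ is the transition matrix of the Markov chain censored on $A$. The group inverse $W^{\#}$ of a finite square matrix $W$ is the unique matrix with $WW^{\#}W=W$, $W^{\#}WW^{\#}=W^{\#}$, $W^{\#}W=WW^{\#}$. $\tau_\alpha:=\inf\{k\ge 1:\Phi_k=\alpha\}$ is the first return time to $\alpha$, $\mathbb I(\cdot)$ is the indicator function, and $\mathbb E_i$ denotes expectation given $\Phi_0=i$. *)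

theory Defs
  imports "HOL-Probability.Probability"
begin

text \<open>
  The state space \<open>E\<close> is the whole countable type. A matrix (or a block of one) is a function of two
  indices; for a block only the values at indices of the block are meaningful, and the product
  carries the set \<open>C\<close> of inner indices as an argument.
\<close>

type_synonym 'a mat = "'a \<Rightarrow> 'a \<Rightarrow> real"

definition mmult :: "'a set \<Rightarrow> 'a mat \<Rightarrow> 'a mat \<Rightarrow> 'a mat" where
  "mmult C X Y = (\<lambda>i j. \<Sum>\<^sub>\<infinity>l\<in>C. X i l * Y l j)"

definition mone :: "'a mat" where
  "mone = (\<lambda>i j. if i = j then 1 else 0)"

text \<open>\<open>mpow C X n\<close> is the \<open>n\<close>-th power of the square block of \<open>X\<close> indexed by \<open>C\<close>.\<close>

primrec mpow :: "'a set \<Rightarrow> 'a mat \<Rightarrow> nat \<Rightarrow> 'a mat" where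
  "mpow C X 0 = mone"
| "mpow C X (Suc n) = mmult C X (mpow C X n)"

definition stochastic_matrix :: "'a mat \<Rightarrow> bool" where
  "stochastic_matrix P \<longleftrightarrow> (\<forall>i j. 0 \<le> P i j) \<and> (\<forall>i. (P i has_sum 1) UNIV)"

definition irreducible_matrix :: "'a mat \<Rightarrow> bool" where
  "irreducible_matrix P \<longleftrightarrow> (\<forall>i j. \<exists>n. 0 < mpow UNIV P n i j)"

definition invariant_probability_vector :: "'a mat \<Rightarrow> ('a \<Rightarrow> real) \<Rightarrow> bool" where
  "invariant_probability_vector P \<pi> \<longleftrightarrow>
     (\<forall>j. 0 \<le> \<pi> j) \<and> (\<pi> has_sum 1) UNIV \<and> (\<forall>j. ((\<lambda>i. \<pi> i * P i j) has_sum \<pi> j) UNIV)"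

text \<open>\<open>Pr i\<close> is the law of the chain given \<open>\<Phi>\<^sub>0 = i\<close>; the process \<open>\<Phi>\<close> is common to all of them.\<close>

definition markov_chain ::
    "('a \<Rightarrow> 'w measure) \<Rightarrow> (nat \<Rightarrow> 'w \<Rightarrow> 'a) \<Rightarrow> 'a mat \<Rightarrow> bool" where
  "markov_chain Pr \<Phi> P \<longleftrightarrow> stochastic_matrix P \<and>
     (\<forall>i. prob_space (Pr i) \<and>
        (\<forall>k. \<Phi> k \<in> measurable (Pr i) (count_space UNIV)) \<and>
        (AE \<omega> in Pr i. \<Phi> 0 \<omega> = i) \<and>
        (\<forall>n x j. 0 < \<P>(\<omega> in Pr i. \<forall>k\<le>n. \<Phi> k \<omega> = x k) \<longrightarrow>
           \<P>(\<omega> in Pr i. \<Phi> (Suc n) \<omega> = j \<bar> \<forall>k\<le>n. \<Phi> k \<omega> = x k) = P (x n) j))"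

text \<open>The infimum of the empty set is \<open>\<infinity>\<close>.\<close>

definition return_time :: "(nat \<Rightarrow> 'w \<Rightarrow> 'a) \<Rightarrow> 'a \<Rightarrow> 'w \<Rightarrow> enat" where
  "return_time \<Phi> \<alpha> \<omega> = Inf (enat ` {k. 1 \<le> k \<and> \<Phi> k \<omega> = \<alpha>})"

definition positive_recurrent :: "('a \<Rightarrow> 'w measure) \<Rightarrow> (nat \<Rightarrow> 'w \<Rightarrow> 'a) \<Rightarrow> bool" where
  "positive_recurrent Pr \<Phi> \<longleftrightarrow>
     (\<forall>i. (\<integral>\<^sup>+ \<omega>. ennreal_of_enat (return_time \<Phi> i \<omega>) \<partial>Pr i) < \<infinity>)"

text \<open>
  The support condition makes the group inverse of the square block of \<open>W\<close> indexed by \<open>A\<close> unique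
  as a function on the whole type.
\<close>

definition is_group_inverse :: "'a set \<Rightarrow> 'a mat \<Rightarrow> 'a mat \<Rightarrow> bool" where
  "is_group_inverse A W G \<longleftrightarrow>
     (\<forall>i j. i \<notin> A \<or> j \<notin> A \<longrightarrow> G i j = 0) \<and>
     (\<forall>i\<in>A. \<forall>j\<in>A. mmult A (mmult A W G) W i j = W i j \<and>
                  mmult A (mmult A G W) G i j = G i j \<and>
                  mmult A G W i j = mmult A W G i j)"

definition group_inverse :: "'a set \<Rightarrow> 'a mat \<Rightarrow> 'a mat" where
  "group_inverse A W = (THE G. is_group_inverse A W G)"

definition P_hat :: "'a set \<Rightarrow> 'a mat \<Rightarrow> 'a mat" where
  "P_hat B P = (\<lambda>i j. \<Sum>n. mpow B P n i j)"

definition censored :: "'a set \<Rightarrow> 'a mat \<Rightarrow> 'a mat" where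
  "censored A P = (\<lambda>i j. P i j + mmult (- A) (mmult (- A) P (P_hat (- A) P)) P i j)"

text \<open>\<open>X_A\<close> gives the rows indexed by \<open>A\<close>, \<open>X_B\<close> those indexed by \<open>B = - A\<close>.\<close>

definition X_A :: "'a set \<Rightarrow> 'a mat \<Rightarrow> ('a \<Rightarrow> real) \<Rightarrow> 'a mat" where
  "X_A A P \<pi> =
     (let PABhat = mmult (- A) P (P_hat (- A) P) in
      mmult A (group_inverse A (\<lambda>i j. mone i j - censored A P i j))
        (\<lambda>i j. (if j \<in> A then mone i j else PABhat i j)
               - (1 + (\<Sum>\<^sub>\<infinity>l\<in>- A. PABhat i l)) * \<pi> j))"

definition X_B :: "'a set \<Rightarrow> 'a mat \<Rightarrow> ('a \<Rightarrow> real) \<Rightarrow> 'a mat" where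
  "X_B A P \<pi> =
     (let Phat = P_hat (- A) P in
      (\<lambda>i j. mmult A (mmult (- A) Phat P) (X_A A P \<pi>) i j
             + (if j \<in> A then 0 else Phat i j)
             - (\<Sum>\<^sub>\<infinity>l\<in>- A. Phat i l) * \<pi> j))"

definition X_tilde :: "'a set \<Rightarrow> 'a mat \<Rightarrow> ('a \<Rightarrow> real) \<Rightarrow> 'a mat" where
  "X_tilde A P \<pi> = (\<lambda>i. if i \<in> A then X_A A P \<pi> i else X_B A P \<pi> i)"

end

theory Submission
  imports Defs
begin

text \<open>
  Write \<open>B = - A\<close>, let \<open>\<tau>\<close> be the first return time to \<open>\<alpha>\<close> and let
  \<open>\<sigma> \<ge> 1\<close> be the first time after zero at which the chain is in \<open>A\<close>. The idea is to cut the
  path of the chain at the time \<open>\<sigma>\<close>.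

  Up to time \<open>\<tau>\<close>, the matrix \<open>K\<close> is the expected number of visits minus \<open>\<pi>\<close> times
  the expected duration, both of which are sums over \<open>n\<close> of powers of the block of \<open>P\<close> that avoids
  \<open>\<alpha>\<close> (\<open>integral_before_return\<close>). Since \<open>\<alpha> \<in> A\<close>, the cut at
  \<open>\<sigma> \<le> \<tau>\<close> falls within the cycle. With \<open>Q(i,l)\<close> the probability of entering
  \<open>A\<close> at \<open>l\<close>, \<open>N(i,j)\<close> the expected number of visits to \<open>j\<close> before
  \<open>\<sigma>\<close>, and \<open>m(i)\<close> the expectation of \<open>\<sigma>\<close>, this gives, for every starting state
  \<open>i\<close>, the equation \<open>K(i,j) = \<Sum>\<^sub>l\<^sub>\<in>\<^sub>A Q(i,l) K(l,j) + N(i,j) - m(i) \<pi>(j)\<close>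
  (\<open>deviation_equation\<close>). The missing term \<open>l = \<alpha>\<close> may be added because
  \<open>K(\<alpha>,\<cdot>) = 0\<close>: expected occupation times over a cycle from \<open>\<alpha>\<close> to
  \<open>\<alpha>\<close> are proportional to \<open>\<pi>\<close> (\<open>deviation_alpha\<close>).

  All the blocks in the definition of \<open>X\<close> are pieces of these three objects. On the rows \<open>A\<close>,
  \<open>Q\<close> is the censored matrix, \<open>N\<close> is \<open>[I, P\<^sub>A\<^sub>B P\<^sub>B\<^sub>B-hat]\<close> and
  \<open>m\<close> is \<open>e + P\<^sub>A\<^sub>B P\<^sub>B\<^sub>B-hat e\<close>; on the rows \<open>B\<close> they are
  \<open>P\<^sub>B\<^sub>B-hat P\<^sub>B\<^sub>A\<close>, \<open>[O, P\<^sub>B\<^sub>B-hat]\<close> and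
  \<open>P\<^sub>B\<^sub>B-hat e\<close>. So, with \<open>W = I - Q\<close> on \<open>A\<close> and
  \<open>R = N - m \<pi>\<^sup>T\<close>, the rows of \<open>K\<close> satisfy \<open>W K\<^sub>A = R\<^sub>A\<close> whereas
  \<open>X\<^sub>A\<close> is the group inverse of \<open>W\<close> applied to \<open>R\<^sub>A\<close>. Then
  \<open>W X\<^sub>A = W W\<^sup># W K\<^sub>A = W K\<^sub>A\<close>, and the columns of \<open>X\<^sub>A - K\<^sub>A\<close> are
  harmonic for the censored chain. A maximum principle makes them constant (\<open>harmonic_constant\<close>), and the row
  \<open>\<alpha>\<close>, where \<open>K\<close> vanishes, identifies the constant as \<open>\<beta>\<close>. The rows
  \<open>B\<close> follow because both \<open>K\<close> and \<open>X\<close> satisfy the equation above there, and the rows of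
  \<open>Q\<close> have sum one.

  The group inverse exists because \<open>W K\<^sub>A\<^sub>A = I - m \<pi>\<^sub>A\<^sup>T\<close> already inverts \<open>W\<close>
  up to a matrix of rank one (\<open>group_inverse_exists\<close>).

  Sums of nonnegative terms are handled as integrals with values in \<open>[0,\<infinity>]\<close>, where they may be rearranged
  freely; the passage to real matrices comes after finiteness has been established.
\<close>


section \<open>Nonnegative kernels and their potentials\<close>

lemma has_sum_iff_nn_integral_count_space:
  fixes f :: "'a \<Rightarrow> real"
  assumes "\<And>x. x \<in> C \<Longrightarrow> 0 \<le> f x" "0 \<le> r"
  shows "(f has_sum r) C \<longleftrightarrow> (\<integral>\<^sup>+x. ennreal (f x) \<partial>count_space C) = ennreal r"
proof -
  have abs: "Infinite_Set_Sum.abs_summable_on f C \<longleftrightarrow> integrable (count_space C) f"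
    by (simp add: abs_summable_on_def)
  have sm: "f summable_on C \<longleftrightarrow> integrable (count_space C) f"
    using abs abs_summable_equivalent[of f C] summable_on_iff_abs_summable_on_real[of f C] by argo
  have eq: "(\<integral>\<^sup>+x. ennreal (f x) \<partial>count_space C) = ennreal (infsum f C)" if "integrable (count_space C) f"
    using that assms(1) nn_integral_conv_infsetsum[of f C] infsetsum_infsum[of f C] abs by simp
  show ?thesis
  proof
    assume h: "(f has_sum r) C"
    then have "integrable (count_space C) f" "infsum f C = r"
      using sm has_sum_iff by blast+
    then show "(\<integral>\<^sup>+x. ennreal (f x) \<partial>count_space C) = ennreal r" using eq by simp
  next
    assume h: "(\<integral>\<^sup>+x. ennreal (f x) \<partial>count_space C) = ennreal r"
    have i: "integrable (count_space C) f"
      by (rule integrableI_nn_integral_finite[where x=r]) (use assms h in \<open>auto simp: AE_count_space\<close>)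
    then have "ennreal (infsum f C) = ennreal r" using eq h by simp
    then have "infsum f C = r" using assms infsum_nonneg[of C f] by simp
    then show "(f has_sum r) C" using i sm has_sum_iff by blast
  qed
qed

definition kapp :: "('a \<Rightarrow> 'a \<Rightarrow> ennreal) \<Rightarrow> ('a \<Rightarrow> ennreal) \<Rightarrow> 'a \<Rightarrow> ennreal" where
  "kapp q v i = (\<integral>\<^sup>+l. q i l * v l \<partial>count_space UNIV)"

definition potential :: "('a \<Rightarrow> 'a \<Rightarrow> ennreal) \<Rightarrow> ('a \<Rightarrow> ennreal) \<Rightarrow> 'a \<Rightarrow> ennreal" where
  "potential q v i = (\<Sum>n. (kapp q ^^ n) v i)"

abbreviation point :: "'a \<Rightarrow> 'a \<Rightarrow> ennreal" where
  "point j \<equiv> (\<lambda>i. of_bool (i = j))"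

lemma kapp_add: "kapp q (\<lambda>i. v i + w i) = (\<lambda>i. kapp q v i + kapp q w i)"
  by (rule ext) (simp add: kapp_def distrib_left nn_integral_add)

lemma kapp_cmult: "kapp q (\<lambda>i. v i * c) = (\<lambda>i. kapp q v i * c)"
  by (rule ext) (simp add: kapp_def nn_integral_multc flip: mult.assoc)

text \<open>
  Monotone convergence: this is what makes the potential a solution of the equation \<open>y = v + q y\<close>.
\<close>

lemma kapp_suminf: "kapp q (\<lambda>i. \<Sum>n. v n i) i = (\<Sum>n. kapp q (v n) i)"
  by (simp add: kapp_def nn_integral_suminf flip: ennreal_suminf_cmult)

lemma kapp_mono: "(\<And>l. q i l \<le> q' i l) \<Longrightarrow> (\<And>l. v l \<le> w l) \<Longrightarrow> kapp q v i \<le> kapp q' w i"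
  unfolding kapp_def by (intro nn_integral_mono mult_mono) auto

lemma kapp_zero [simp]: "kapp q (\<lambda>i. 0) = (\<lambda>i. 0)"
  by (rule ext) (simp add: kapp_def)

lemma kapp_pow_zero [simp]: "(kapp q ^^ n) (\<lambda>i. 0) = (\<lambda>i. 0)"
  by (induction n) simp_all

lemma kapp_pow_add: "(kapp q ^^ n) (\<lambda>i. v i + w i) = (\<lambda>i. (kapp q ^^ n) v i + (kapp q ^^ n) w i)"
  by (induction n) (simp_all add: kapp_add)

lemma kapp_pow_cmult: "(kapp q ^^ n) (\<lambda>i. v i * c) = (\<lambda>i. (kapp q ^^ n) v i * c)"
  by (induction n) (simp_all add: kapp_cmult)

lemma kapp_pow_mono:
  "(\<And>i l. q i l \<le> q' i l) \<Longrightarrow> (\<And>l. v l \<le> w l) \<Longrightarrow> (kapp q ^^ n) v i \<le> (kapp q' ^^ n) w i"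
  by (induction n arbitrary: i) (auto intro: kapp_mono)

lemma potential_zero: "potential q (\<lambda>i. 0) = (\<lambda>i. 0)"
  by (rule ext) (simp add: potential_def)

lemma potential_add: "potential q (\<lambda>i. v i + w i) i = potential q v i + potential q w i"
  by (simp add: potential_def kapp_pow_add suminf_add)

lemma potential_cmult: "potential q (\<lambda>i. v i * c) i = potential q v i * c"
  by (simp add: potential_def kapp_pow_cmult)

lemma potential_sum: "finite L \<Longrightarrow> potential q (\<lambda>i. \<Sum>l\<in>L. w l i) i = (\<Sum>l\<in>L. potential q (w l) i)"
  by (induction rule: finite_induct) (simp_all add: potential_zero potential_add)

lemma potential_mono:
  "(\<And>i l. q i l \<le> q' i l) \<Longrightarrow> (\<And>l. v l \<le> w l) \<Longrightarrow> potential q v i \<le> potential q' w i"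
  unfolding potential_def by (intro suminf_le kapp_pow_mono) auto

lemma potential_unfold: "potential q v i = v i + kapp q (potential q v) i"
proof -
  have "potential q v i = (kapp q ^^ 0) v i + (\<Sum>n. (kapp q ^^ Suc n) v i)"
    unfolding potential_def by (subst suminf_offset[of _ 1]) auto
  also have "(\<Sum>n. (kapp q ^^ Suc n) v i) = kapp q (potential q v) i"
    by (simp add: potential_def[abs_def] kapp_suminf)
  finally show ?thesis by simp
qed

lemma kapp_potential_le: "kapp q (potential q v) i \<le> potential q v i"
  by (subst potential_unfold[of q v i]) simp

text \<open>
  A solution of \<open>y = r + q y\<close> differs from the partial sums of the potential of \<open>r\<close> by the remainder
  \<open>q\<^sup>n y\<close>. Uniqueness thus amounts to the remainder tending to zero.
\<close>

lemma iterate_equation: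
  assumes "\<And>i. y i = r i + kapp q y i"
  shows "y i = (\<Sum>k<n. (kapp q ^^ k) r i) + (kapp q ^^ n) y i"
proof (induction n arbitrary: i)
  case (Suc n)
  have "(kapp q ^^ n) y i = (kapp q ^^ n) (\<lambda>i. r i + kapp q y i) i"
    using arg_cong[where f="\<lambda>v. (kapp q ^^ n) v i", OF ext[OF assms]] .
  also have "\<dots> = (kapp q ^^ n) r i + (kapp q ^^ Suc n) y i"
    by (simp only: kapp_pow_add funpow_Suc_right o_apply)
  finally show ?case using Suc[of i] by (simp add: add.assoc)
qed simp

lemma potential_unique:
  assumes "\<And>i. y i = r i + kapp q y i" and "(\<lambda>n. (kapp q ^^ n) y i) \<longlonglongrightarrow> 0"
  shows "y i = potential q r i"
proof -
  have "(\<lambda>n. (\<Sum>k<n. (kapp q ^^ k) r i) + (kapp q ^^ n) y i) \<longlonglongrightarrow> potential q r i + 0"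
    unfolding potential_def by (intro tendsto_add summable_LIMSEQ assms) auto
  moreover have "(\<lambda>n. (\<Sum>k<n. (kapp q ^^ k) r i) + (kapp q ^^ n) y i) = (\<lambda>n. y i)"
    by (intro ext iterate_equation[OF assms(1), symmetric])
  ultimately show ?thesis by (simp add: LIMSEQ_const_iff)
qed

text \<open>
  The remainder \<open>q\<^sup>n (potential q v)\<close> is the tail of the series that defines the potential. It tends to zero at
  every state where the series converges.
\<close>

lemma kapp_pow_potential_tendsto_0:
  assumes "potential q v i < \<infinity>"
  shows "(\<lambda>n. (kapp q ^^ n) (potential q v) i) \<longlonglongrightarrow> 0"
proof -
  let ?s = "\<lambda>n. \<Sum>k<n. (kapp q ^^ k) v i"
  have "?s n + (kapp q ^^ n) (potential q v) i = potential q v i" for n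
    using iterate_equation[of "potential q v" v q i n, OF potential_unfold] by simp
  then have "(kapp q ^^ n) (potential q v) i = potential q v i - ?s n" for n
    using assms by (metis ennreal_add_diff_cancel_left ennreal_add_eq_top infinity_ennreal_def order_less_irrefl)
  moreover have "(\<lambda>n. potential q v i - ?s n) \<longlonglongrightarrow> potential q v i - potential q v i"
    using assms by (intro tendsto_diff_ennreal tendsto_const)
      (auto simp: potential_def intro: summable_LIMSEQ)
  ultimately show ?thesis using assms by simp
qed

lemma kapp_pow_tendsto_0:
  assumes "potential q v i < \<infinity>"
  shows "(\<lambda>n. (kapp q ^^ n) v i) \<longlonglongrightarrow> 0"
proof (rule tendsto_sandwich[OF _ _ tendsto_const kapp_pow_potential_tendsto_0[OF assms]])
  have "v l \<le> potential q v l" for l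
    by (subst potential_unfold) simp
  then show "\<forall>\<^sub>F n in sequentially. (kapp q ^^ n) v i \<le> (kapp q ^^ n) (potential q v) i"
    by (intro always_eventually allI kapp_pow_mono) auto
qed simp

lemma potential_eq_self:
  assumes "kapp q v = (\<lambda>_. 0)"
  shows "potential q v i = v i"
proof -
  have "(kapp q ^^ n) v i = 0" if "n \<noteq> 0" for n
    using that assms by (cases n) (simp_all add: funpow_swap1)
  then have "potential q v i = (\<Sum>n\<in>{0}. (kapp q ^^ n) v i)"
    unfolding potential_def by (intro suminf_finite) auto
  then show ?thesis by simp
qed

text \<open>
  Every \<open>v\<close> is the superposition of the point functions with weights \<open>v l\<close>, and \<open>q\<^sup>n\<close>
  is linear. The exchange of the two integrals relies on the countability of the state space.
\<close>

lemma kapp_pow_integral: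
  fixes q :: "'a::countable \<Rightarrow> 'a \<Rightarrow> ennreal"
  shows "(kapp q ^^ n) v i = (\<integral>\<^sup>+l. (kapp q ^^ n) (point l) i * v l \<partial>count_space UNIV)"
proof (induction n arbitrary: i)
  case 0
  have "(\<integral>\<^sup>+l. of_bool (i = l) * v l \<partial>count_space UNIV) = (\<integral>\<^sup>+l. v l * indicator {i} l \<partial>count_space UNIV)"
    by (intro nn_integral_cong) (auto split: split_indicator)
  then show ?case by simp
next
  case (Suc n)
  have "(kapp q ^^ Suc n) v i = (\<integral>\<^sup>+m. q i m * (\<integral>\<^sup>+l. (kapp q ^^ n) (point l) m * v l \<partial>count_space UNIV) \<partial>count_space UNIV)"
    by (simp add: Suc[symmetric] kapp_def[of q "(kapp q ^^ n) v"])
  also have "\<dots> = (\<integral>\<^sup>+m. (\<integral>\<^sup>+l. q i m * (kapp q ^^ n) (point l) m * v l \<partial>count_space UNIV) \<partial>count_space UNIV)"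
    by (simp add: mult.assoc nn_integral_cmult)
  also have "\<dots> = (\<integral>\<^sup>+l. (\<integral>\<^sup>+m. q i m * (kapp q ^^ n) (point l) m * v l \<partial>count_space UNIV) \<partial>count_space UNIV)"
    by (rule nn_integral_count_space_nn_integral) auto
  also have "\<dots> = (\<integral>\<^sup>+l. (kapp q ^^ Suc n) (point l) i * v l \<partial>count_space UNIV)"
    by (simp add: nn_integral_multc kapp_def)
  finally show ?case .
qed

lemma potential_integral:
  fixes q :: "'a::countable \<Rightarrow> 'a \<Rightarrow> ennreal"
  shows "potential q v i = (\<integral>\<^sup>+l. potential q (point l) i * v l \<partial>count_space UNIV)"
  unfolding potential_def
  by (subst kapp_pow_integral) (simp add: nn_integral_suminf flip: ennreal_suminf_multc)

section \<open>Taboo kernels of a transition matrix\<close>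

text \<open>
  The matrix \<open>P\<close> with the columns outside \<open>B\<close> replaced by zero, so that steps leaving \<open>B\<close> are
  killed. Its rows are not restricted to \<open>B\<close>: the chain may start anywhere, and only the states after time zero must
  lie in \<open>B\<close>. This lets one formula serve for the rows in \<open>B\<close> and for those outside it.
\<close>

definition taboo :: "'a mat \<Rightarrow> 'a set \<Rightarrow> 'a \<Rightarrow> 'a \<Rightarrow> ennreal" where
  "taboo P B i l = ennreal (P i l) * indicator B l"

lemma kapp_taboo: "kapp (taboo P B) v i = (\<integral>\<^sup>+l. ennreal (P i l) * v l \<partial>count_space B)"
  unfolding kapp_def taboo_def
  by (subst (2) nn_integral_count_space_indicator)
    (auto intro!: nn_integral_cong split: split_indicator)

text \<open>
  An infinite sum that is not absolutely convergent has the default value \<open>0\<close>, so the product of two nonnegative blocks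
  agrees with its value in \<open>[0,\<infinity>]\<close> only when the latter is finite.
\<close>

lemma mmult_eq_enn2real:
  assumes "\<And>l. l \<in> C \<Longrightarrow> 0 \<le> X i l" "\<And>l. l \<in> C \<Longrightarrow> 0 \<le> Y l j"
    and "(\<integral>\<^sup>+l. ennreal (X i l) * ennreal (Y l j) \<partial>count_space C) = e" "e < \<infinity>"
  shows "mmult C X Y i j = enn2real e"
proof -
  have "(\<integral>\<^sup>+l. ennreal (X i l * Y l j) \<partial>count_space C) = ennreal (enn2real e)"
    using assms by (subst ennreal_enn2real)
      (auto simp: less_top ennreal_mult intro!: nn_integral_cong)
  then have "((\<lambda>l. X i l * Y l j) has_sum enn2real e) C"
    using assms by (subst has_sum_iff_nn_integral_count_space) auto
  then show ?thesis unfolding mmult_def by (rule infsumI)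
qed

lemma infsum_eq_enn2real:
  assumes "\<And>l. l \<in> C \<Longrightarrow> 0 \<le> f l" "(\<integral>\<^sup>+l. ennreal (f l) \<partial>count_space C) = e" "e < \<infinity>"
  shows "infsum f C = enn2real e"
  using mmult_eq_enn2real[of C "\<lambda>_. f" undefined "\<lambda>_ _. 1" undefined e] assms
  by (simp add: mmult_def)

text \<open>
  A column outside \<open>B\<close> cannot be reached after time zero, so only the visit at time zero counts.
\<close>

lemma potential_point_outside:
  "j \<notin> B \<Longrightarrow> potential (taboo P B) (point j) i = of_bool (i = j)"
proof (rule potential_eq_self, rule ext)
  fix i assume "j \<notin> B"
  then have "(\<lambda>l. taboo P B i l * of_bool (l = j)) = (\<lambda>_. 0)"
    by (auto simp: taboo_def fun_eq_iff)
  then show "kapp (taboo P B) (point j) i = 0"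
    unfolding kapp_def by simp
qed

locale transition_matrix =
  fixes P :: "'a::countable \<Rightarrow> 'a \<Rightarrow> real"
  assumes stochastic: "stochastic_matrix P"
begin

lemma P_nonneg [simp]: "0 \<le> P i j"
  using stochastic by (simp add: stochastic_matrix_def)

lemma row_sum: "(\<integral>\<^sup>+l. ennreal (P i l) \<partial>count_space UNIV) = 1"
  using stochastic has_sum_iff_nn_integral_count_space[of UNIV "P i" 1]
  by (simp add: stochastic_matrix_def)

lemma P_le_1: "ennreal (P i l) \<le> 1"
proof -
  have "ennreal (P i l) \<le> (\<integral>\<^sup>+l. ennreal (P i l) \<partial>count_space UNIV)"
    by (rule nn_integral_ge_point) simp
  then show ?thesis by (simp add: row_sum)
qed

lemma kapp_le_1:
  assumes "\<And>l. v l \<le> 1"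
  shows "kapp (taboo P B) v i \<le> 1"
proof -
  have "kapp (taboo P B) v i \<le> (\<integral>\<^sup>+l. ennreal (P i l) \<partial>count_space UNIV)"
    unfolding kapp_def
  proof (intro nn_integral_mono)
    fix l
    show "taboo P B i l * v l \<le> ennreal (P i l)"
      using mult_left_mono[OF assms, of "ennreal (P i l)" l]
      by (auto simp: taboo_def split: split_indicator)
  qed
  then show ?thesis by (simp add: row_sum)
qed

lemma kapp_pow_le_1: "(\<And>l. v l \<le> 1) \<Longrightarrow> (kapp (taboo P B) ^^ n) v i \<le> 1"
  by (induction n arbitrary: i) (auto intro: kapp_le_1)

lemma mpow_eq: "mpow C P n i j = enn2real ((kapp (taboo P C) ^^ n) (point j) i)"
proof (induction n arbitrary: i)
  case 0
  show ?case by (simp add: mone_def)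
next
  case (Suc n)
  have le: "(kapp (taboo P C) ^^ n) (point j) l \<le> 1" for n l
    by (rule kapp_pow_le_1) simp
  then have fin: "(kapp (taboo P C) ^^ n) (point j) l < \<infinity>" for n l
    by (metis ennreal_one_less_top infinity_ennreal_def order_le_less_trans)
  show ?case
    unfolding mpow.simps
  proof (rule mmult_eq_enn2real)
    have "ennreal (mpow C P n l j) = (kapp (taboo P C) ^^ n) (point j) l" for l
      using fin[of n l] by (simp add: Suc)
    then show "(\<integral>\<^sup>+l. ennreal (P i l) * ennreal (mpow C P n l j) \<partial>count_space C)
        = (kapp (taboo P C) ^^ Suc n) (point j) i"
      by (simp add: kapp_taboo)
  qed (simp_all only: Suc fin P_nonneg enn2real_nonneg)
qed

lemma mpow_nonneg: "0 \<le> mpow C P n i j"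
  by (simp add: mpow_eq)

lemma ennreal_mpow: "ennreal (mpow C P n i j) = (kapp (taboo P C) ^^ n) (point j) i"
proof -
  have "(kapp (taboo P C) ^^ n) (point j) i \<le> 1"
    by (rule kapp_pow_le_1) simp
  then show ?thesis
    by (metis mpow_eq ennreal_enn2real ennreal_one_less_top order_le_less_trans)
qed

lemma P_hat_eq:
  assumes "potential (taboo P C) (point j) i < \<infinity>"
  shows "P_hat C P i j = enn2real (potential (taboo P C) (point j) i)"
proof -
  have eq: "potential (taboo P C) (point j) i = (\<Sum>n. ennreal (mpow C P n i j))"
    by (simp add: potential_def ennreal_mpow)
  then have summ: "summable (\<lambda>n. mpow C P n i j)"
    using assms by (intro summable_suminf_not_top) (auto simp: mpow_nonneg)
  have "(\<Sum>n. ennreal (mpow C P n i j)) = ennreal (\<Sum>n. mpow C P n i j)"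
    by (intro suminf_ennreal_eq summable_sums[OF summ] mpow_nonneg)
  then show ?thesis
    unfolding P_hat_def eq by (simp only: enn2real_ennreal[OF suminf_nonneg[OF summ mpow_nonneg]])
qed

lemma split_finite_columns:
  assumes "finite L" "L \<inter> B = {}"
  shows "kapp (taboo P (B \<union> L)) v i = (\<Sum>l\<in>L. ennreal (P i l) * v l) + kapp (taboo P B) v i"
proof -
  have "kapp (taboo P (B \<union> L)) v i
      = (\<integral>\<^sup>+l. ennreal (P i l) * v l * indicator L l + taboo P B i l * v l \<partial>count_space UNIV)"
    unfolding kapp_def
    by (intro nn_integral_cong) (use assms in \<open>auto simp: taboo_def split: split_indicator\<close>)
  also have "\<dots> = (\<integral>\<^sup>+l. ennreal (P i l) * v l * indicator L l \<partial>count_space UNIV) + kapp (taboo P B) v i"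
    by (simp add: nn_integral_add kapp_def)
  also have "(\<integral>\<^sup>+l. ennreal (P i l) * v l * indicator L l \<partial>count_space UNIV) = (\<Sum>l\<in>L. ennreal (P i l) * v l)"
    using assms by (simp add: nn_integral_count_space_finite flip: nn_integral_count_space_indicator)
  finally show ?thesis .
qed

text \<open>
  The probability that the first state outside \<open>B\<close> after time zero is \<open>l\<close>, provided
  \<open>l \<notin> B\<close>: the chain makes \<open>n\<close> steps inside \<open>B\<close> and then jumps to \<open>l\<close>.
\<close>

definition hitting :: "'a set \<Rightarrow> 'a \<Rightarrow> 'a \<Rightarrow> ennreal" where
  "hitting B i l = potential (taboo P B) (\<lambda>i. ennreal (P i l)) i"

text \<open>
  The path that stays in \<open>B \<union> L\<close> is cut when it first enters \<open>L\<close>; before this time it stays in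
  \<open>B\<close>, and afterwards it starts afresh. Analytically, the potential \<open>y\<close> for \<open>B \<union> L\<close>
  solves \<open>y = r + q y\<close> with the smaller kernel \<open>q\<close> for \<open>B\<close> and \<open>r\<close> the part of
  the equation from the columns in \<open>L\<close>, and the remainder is dominated by the one for \<open>B \<union> L\<close>,
  which tends to zero.
\<close>

lemma potential_first_entrance:
  assumes "finite L" "L \<inter> B = {}" "potential (taboo P (B \<union> L)) w i < \<infinity>"
  shows "potential (taboo P (B \<union> L)) w i
    = potential (taboo P B) w i + (\<Sum>l\<in>L. hitting B i l * potential (taboo P (B \<union> L)) w l)"
proof -
  define y where "y = potential (taboo P (B \<union> L)) w"
  define r where "r i = w i + (\<Sum>l\<in>L. ennreal (P i l) * y l)" for i
  have "y i = potential (taboo P B) r i"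
  proof (rule potential_unique)
    fix i
    have "y i = w i + kapp (taboo P (B \<union> L)) y i"
      unfolding y_def by (rule potential_unfold)
    then show "y i = r i + kapp (taboo P B) y i"
      using assms by (simp add: split_finite_columns r_def add.assoc)
  next
    have "(\<lambda>n. (kapp (taboo P (B \<union> L)) ^^ n) y i) \<longlonglongrightarrow> 0"
      unfolding y_def using assms(3) by (rule kapp_pow_potential_tendsto_0)
    then show "(\<lambda>n. (kapp (taboo P B) ^^ n) y i) \<longlonglongrightarrow> 0"
      by (rule tendsto_sandwich[OF _ _ tendsto_const, rotated 2])
        (auto intro!: always_eventually kapp_pow_mono simp: taboo_def split: split_indicator)
  qed
  also have "\<dots> = potential (taboo P B) w i + (\<Sum>l\<in>L. hitting B i l * y l)"
    using assms(1) by (simp add: r_def[abs_def] potential_add potential_sum potential_cmult hitting_def)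
  finally show ?thesis by (simp add: y_def)
qed

text \<open>
  When the entrance time into \<open>A\<close> has finite mean, the chain enters \<open>A\<close> almost surely: the function
  \<open>1\<close> solves the equation whose source is the probability of a jump into \<open>A\<close>.
\<close>

lemma hitting_sum:
  assumes "finite A" "potential (taboo P (- A)) (\<lambda>_. 1) i < \<infinity>"
  shows "(\<Sum>l\<in>A. hitting (- A) i l) = 1"
proof -
  have "1 = potential (taboo P (- A)) (\<lambda>i. \<Sum>l\<in>A. ennreal (P i l)) i"
  proof (rule potential_unique)
    fix i
    have "kapp (taboo P UNIV) (\<lambda>_. 1) i = 1"
      by (simp add: kapp_taboo row_sum)
    then show "1 = (\<Sum>l\<in>A. ennreal (P i l)) + kapp (taboo P (- A)) (\<lambda>_. 1) i"
      using split_finite_columns[of A "- A" "\<lambda>_. 1" i] assms(1) by simp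
  qed (rule kapp_pow_tendsto_0[OF assms(2)])
  then show ?thesis
    using assms(1) by (simp add: potential_sum hitting_def del: sum_ennreal)
qed

lemma hitting_unfold:
  "hitting B i l = ennreal (P i l) + kapp (taboo P B) (\<lambda>i. hitting B i l) i"
  unfolding hitting_def by (rule potential_unfold)

text \<open>
  The cycle formula: an invariant measure of finite mass is recovered from its restriction to \<open>A\<close> by adding up the
  visits on excursions that start in \<open>A\<close>. Invariance moves one step of the kernel between \<open>p\<close> and
  \<open>v\<close>; each such step splits off the contribution of \<open>A\<close>. The contribution still outside \<open>A\<close>
  after \<open>n\<close> steps vanishes by dominated convergence with the integrable bound \<open>p\<close>.
\<close>

lemma invariant_integral:
  fixes p :: "'a \<Rightarrow> ennreal"
  assumes "finite A" and fin: "\<And>i. potential (taboo P (- A)) (\<lambda>_. 1) i < \<infinity>"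
    and inv: "\<And>j. (\<integral>\<^sup>+i. p i * ennreal (P i j) \<partial>count_space UNIV) = p j"
    and mass: "(\<integral>\<^sup>+i. p i \<partial>count_space UNIV) < \<infinity>"
    and le: "\<And>i. v i \<le> 1"
  shows "(\<integral>\<^sup>+i. p i * v i \<partial>count_space UNIV) = (\<Sum>i\<in>A. p i * potential (taboo P (- A)) v i)"
proof -
  let ?T = "kapp (taboo P (- A))"
  have dual: "(\<integral>\<^sup>+i. p i * ?T v i \<partial>count_space UNIV) = (\<integral>\<^sup>+i. p i * v i * indicator (- A) i \<partial>count_space UNIV)" for v
  proof -
    have "(\<integral>\<^sup>+i. p i * ?T v i \<partial>count_space UNIV)
        = (\<integral>\<^sup>+i. (\<integral>\<^sup>+l. p i * ennreal (P i l) * (v l * indicator (- A) l) \<partial>count_space UNIV) \<partial>count_space UNIV)"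
      unfolding kapp_def taboo_def
      by (subst nn_integral_cmult[symmetric]) (simp_all add: mult_ac)
    also have "\<dots> = (\<integral>\<^sup>+l. (\<integral>\<^sup>+i. p i * ennreal (P i l) * (v l * indicator (- A) l) \<partial>count_space UNIV) \<partial>count_space UNIV)"
      by (rule nn_integral_count_space_nn_integral) auto
    also have "\<dots> = (\<integral>\<^sup>+l. p l * v l * indicator (- A) l \<partial>count_space UNIV)"
      by (simp add: nn_integral_multc inv) (simp add: mult.assoc)
    finally show ?thesis .
  qed
  define D where "D n = (\<integral>\<^sup>+i. p i * (?T ^^ n) v i \<partial>count_space UNIV)" for n
  have step: "D n = (\<Sum>i\<in>A. p i * (?T ^^ n) v i) + D (Suc n)" for n
  proof -
    have "D n = (\<integral>\<^sup>+i. p i * (?T ^^ n) v i * indicator A i + p i * (?T ^^ n) v i * indicator (- A) i \<partial>count_space UNIV)"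
      unfolding D_def by (intro nn_integral_cong) (auto split: split_indicator)
    also have "\<dots> = (\<integral>\<^sup>+i. p i * (?T ^^ n) v i * indicator A i \<partial>count_space UNIV) + D (Suc n)"
      by (subst nn_integral_add) (simp_all add: D_def dual)
    finally show ?thesis
      using assms(1) by (simp add: nn_integral_count_space_finite flip: nn_integral_count_space_indicator)
  qed
  have "(\<Sum>k<n. \<Sum>i\<in>A. p i * (?T ^^ k) v i) + D n = D 0" for n
  proof (induction n)
    case (Suc n)
    then show ?case using step[of n] by (simp add: add.assoc)
  qed simp
  moreover have "(\<lambda>n. (\<Sum>k<n. \<Sum>i\<in>A. p i * (?T ^^ k) v i) + D n)
      \<longlonglongrightarrow> (\<Sum>k. \<Sum>i\<in>A. p i * (?T ^^ k) v i) + 0"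
  proof (intro tendsto_add summable_LIMSEQ)
    have lim: "(\<lambda>n. (?T ^^ n) v i) \<longlonglongrightarrow> 0" for i
    proof (rule kapp_pow_tendsto_0, rule order_le_less_trans[OF _ fin])
      show "potential (taboo P (- A)) v i \<le> potential (taboo P (- A)) (\<lambda>_. 1) i"
        by (intro potential_mono le) simp
    qed
    have pfin: "p i < \<infinity>" for i
    proof -
      have "p i \<le> (\<integral>\<^sup>+i. p i \<partial>count_space UNIV)"
        by (rule nn_integral_ge_point) simp
      then show ?thesis using mass by (rule order_le_less_trans)
    qed
    have "D \<longlonglongrightarrow> (\<integral>\<^sup>+(i::'a). 0 \<partial>count_space UNIV)"
      unfolding D_def
    proof (rule nn_integral_dominated_convergence[where w=p and u'="\<lambda>_. 0" and u="\<lambda>n i. p i * (?T ^^ n) v i"])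
      fix n
      show "AE i in count_space UNIV. p i * (?T ^^ n) v i \<le> p i"
        using mult_left_mono[OF kapp_pow_le_1[where B="- A" and n=n, OF le], of "p _"]
        by (intro always_eventually) auto
    next
      show "AE i in count_space UNIV. (\<lambda>n. p i * (?T ^^ n) v i) \<longlonglongrightarrow> 0"
      proof (intro always_eventually allI)
        fix i
        show "(\<lambda>n. p i * (?T ^^ n) v i) \<longlonglongrightarrow> 0"
          using ennreal_tendsto_cmult[OF _ lim[of i], of "p i"] pfin[of i] by simp
      qed
    qed (use mass in auto)
    then show "D \<longlonglongrightarrow> 0" by simp
  qed auto
  ultimately have "D 0 = (\<Sum>k. \<Sum>i\<in>A. p i * (?T ^^ k) v i)"
    by (simp add: LIMSEQ_const_iff)
  also have "\<dots> = (\<Sum>i\<in>A. \<Sum>k. p i * (?T ^^ k) v i)"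
    by (rule suminf_sum) auto
  finally show ?thesis
    by (simp add: D_def potential_def)
qed

lemma mpow_pos_step:
  assumes "0 < mpow UNIV P (Suc n) i j"
  obtains l where "0 < P i l" "0 < mpow UNIV P n l j"
proof (rule ccontr)
  assume "\<not> thesis"
  then have "P i l * mpow UNIV P n l j = 0" for l
    using that[of l] P_nonneg[of i l] mpow_nonneg[of UNIV n l j] by (auto simp: less_le)
  then have "(\<lambda>l. P i l * mpow UNIV P n l j) = (\<lambda>_. 0)" by blast
  then show False using assms by (simp add: mmult_def)
qed

lemma closed_set_eq_UNIV:
  assumes "irreducible_matrix P" "a \<in> S" and closed: "\<And>i l. i \<in> S \<Longrightarrow> 0 < P i l \<Longrightarrow> l \<in> S"
  shows "j \<in> S"
proof -
  have "i \<in> S \<Longrightarrow> 0 < mpow UNIV P n i j \<Longrightarrow> j \<in> S" for n i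
  proof (induction n arbitrary: i)
    case 0
    then show ?case by (auto simp: mone_def split: if_splits)
  next
    case (Suc n)
    then show ?case using closed by (meson mpow_pos_step)
  qed
  then show ?thesis using assms unfolding irreducible_matrix_def by blast
qed

text \<open>
  If the mean time to reach \<open>a\<close> is finite from \<open>i\<close>, the equation \<open>h = 1 + q h\<close> bounds it at
  every state \<open>l \<noteq> a\<close> to which one step from \<open>i\<close> leads. The states with finite mean thus form a
  closed set.
\<close>

lemma finite_return_time_everywhere:
  assumes "irreducible_matrix P" "potential (taboo P (- {a})) (\<lambda>_. 1) a < \<infinity>"
  shows "potential (taboo P (- {a})) (\<lambda>_. 1) i < \<infinity>"
proof -
  let ?h = "potential (taboo P (- {a})) (\<lambda>_. 1)"
  have "i \<in> {i. ?h i < \<infinity>}"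
  proof (rule closed_set_eq_UNIV[OF assms(1)])
    fix i l
    assume i: "i \<in> {i. ?h i < \<infinity>}" and pos: "0 < P i l"
    show "l \<in> {i. ?h i < \<infinity>}"
    proof (cases "l = a")
      case False
      have "taboo P (- {a}) i l * ?h l \<le> kapp (taboo P (- {a})) ?h i"
        unfolding kapp_def by (rule nn_integral_ge_point) simp
      also have "\<dots> \<le> ?h i"
        by (subst potential_unfold[of _ _ i]) simp
      finally have "ennreal (P i l) * ?h l < \<infinity>"
        using i False by (auto simp: taboo_def)
      then show ?thesis using pos
        by (auto simp: ennreal_mult_less_top less_top)
    qed (use assms in auto)
  qed (use assms in auto)
  then show ?thesis by simp
qed

text \<open>
  The zero set of a nonnegative harmonic function is closed.
\<close>

lemma harmonic_zero:
  assumes "irreducible_matrix P" "\<And>i. w i = (\<integral>\<^sup>+l. ennreal (P i l) * w l \<partial>count_space UNIV)" "w a = 0"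
  shows "w j = 0"
proof -
  have "j \<in> {i. w i = 0}"
  proof (rule closed_set_eq_UNIV[OF assms(1), of a])
    fix i l
    assume i: "i \<in> {i. w i = 0}" and pos: "0 < P i l"
    have "ennreal (P i l) * w l \<le> w i"
      by (subst assms(2)[of i], rule nn_integral_ge_point) simp
    then have "ennreal (P i l) * w l = 0"
      using i by simp
    then show "l \<in> {i. w i = 0}"
      using pos by (simp add: ennreal_eq_0_iff)
  qed (simp add: assms(3))
  then show ?thesis by simp
qed

end

section \<open>The chain before its first return\<close>

lemma return_time_gt_iff: "enat n < return_time \<Phi> \<alpha> \<omega> \<longleftrightarrow> (\<forall>k. 0 < k \<and> k \<le> n \<longrightarrow> \<Phi> k \<omega> \<in> - {\<alpha>})"
proof -
  have "enat n < return_time \<Phi> \<alpha> \<omega> \<longleftrightarrow> \<not> (\<exists>k\<ge>1. k \<le> n \<and> \<Phi> k \<omega> = \<alpha>)"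
  proof
    assume less: "enat n < return_time \<Phi> \<alpha> \<omega>"
    show "\<not> (\<exists>k\<ge>1. k \<le> n \<and> \<Phi> k \<omega> = \<alpha>)"
    proof
      assume "\<exists>k\<ge>1. k \<le> n \<and> \<Phi> k \<omega> = \<alpha>"
      then obtain k where k: "1 \<le> k" "k \<le> n" "\<Phi> k \<omega> = \<alpha>" by blast
      then have "return_time \<Phi> \<alpha> \<omega> \<le> enat k"
        unfolding return_time_def by (intro Inf_lower) auto
      then show False using less k(2) by (meson enat_ord_simps(1) leD order_trans)
    qed
  next
    assume none: "\<not> (\<exists>k\<ge>1. k \<le> n \<and> \<Phi> k \<omega> = \<alpha>)"
    have "enat (Suc n) \<le> return_time \<Phi> \<alpha> \<omega>"
      unfolding return_time_def
    proof (rule Inf_greatest)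
      fix t assume "t \<in> enat ` {k. 1 \<le> k \<and> \<Phi> k \<omega> = \<alpha>}"
      then obtain k where k: "t = enat k" "1 \<le> k" "\<Phi> k \<omega> = \<alpha>" by blast
      then have "\<not> k \<le> n" using none by blast
      then show "enat (Suc n) \<le> t" using k(1) by simp
    qed
    then show "enat n < return_time \<Phi> \<alpha> \<omega>"
      by (metis enat_ord_simps(2) lessI order_less_le_trans)
  qed
  then show ?thesis by (auto simp: Suc_le_eq)
qed

text \<open>
  On an infinite return time the finite sum on the right would take the default value \<open>0\<close>.
\<close>

lemma sum_before_return:
  assumes "return_time \<Phi> \<alpha> \<omega> < \<infinity>"
  shows "(\<Sum>n. indicator {\<omega>. enat n < return_time \<Phi> \<alpha> \<omega> \<and> \<Phi> n \<omega> \<in> D} \<omega>)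
    = ennreal (\<Sum>k | enat k < return_time \<Phi> \<alpha> \<omega>. of_bool (\<Phi> k \<omega> \<in> D))"
proof -
  obtain r where r: "return_time \<Phi> \<alpha> \<omega> = enat r" using assms by auto
  have "(\<Sum>n. indicator {\<omega>. enat n < return_time \<Phi> \<alpha> \<omega> \<and> \<Phi> n \<omega> \<in> D} \<omega> :: ennreal)
      = (\<Sum>n<r. indicator {\<omega>. enat n < return_time \<Phi> \<alpha> \<omega> \<and> \<Phi> n \<omega> \<in> D} \<omega>)"
    by (rule suminf_finite) (auto simp: r)
  also have "\<dots> = (\<Sum>n<r. ennreal (of_bool (\<Phi> n \<omega> \<in> D)))"
    by (intro sum.cong) (auto simp: r)
  also have "\<dots> = ennreal (\<Sum>k | enat k < return_time \<Phi> \<alpha> \<omega>. of_bool (\<Phi> k \<omega> \<in> D))"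
    by (simp add: r lessThan_def)
  finally show ?thesis .
qed

lemma ennreal_of_enat_return_time:
  "ennreal_of_enat (return_time \<Phi> \<alpha> \<omega>) = (\<Sum>n. indicator {\<omega>. enat n < return_time \<Phi> \<alpha> \<omega> \<and> \<Phi> n \<omega> \<in> UNIV} \<omega>)"
proof (cases "return_time \<Phi> \<alpha> \<omega>")
  case (enat k)
  then show ?thesis
    by (subst sum_before_return) (auto simp: ennreal_of_nat_eq_real_of_nat)
next
  case infinity
  have "(\<Sum>n::nat. 1::ennreal) = \<infinity>"
    using nn_integral_count_space_nat[of "\<lambda>_. 1"] by simp
  then show ?thesis using infinity by simp
qed

locale markov_process = transition_matrix P
  for P :: "'a::countable \<Rightarrow> 'a \<Rightarrow> real" +
  fixes Pr :: "'a \<Rightarrow> 'w measure" and \<Phi> :: "nat \<Rightarrow> 'w \<Rightarrow> 'a"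
  assumes chain: "markov_chain Pr \<Phi> P"
begin

lemma prob_space_Pr: "prob_space (Pr i)"
  using chain by (simp add: markov_chain_def)

lemma measurable_\<Phi> [measurable]: "\<Phi> k \<in> measurable (Pr i) (count_space UNIV)"
  using chain by (simp add: markov_chain_def)

lemma starting_state: "AE \<omega> in Pr i. \<Phi> 0 \<omega> = i"
  using chain by (simp add: markov_chain_def)

lemma path_extend:
  "emeasure (Pr i) {\<omega>\<in>space (Pr i). (\<forall>k\<le>n. \<Phi> k \<omega> = x k) \<and> \<Phi> (Suc n) \<omega> = l}
    = emeasure (Pr i) {\<omega>\<in>space (Pr i). \<forall>k\<le>n. \<Phi> k \<omega> = x k} * ennreal (P (x n) l)"
proof -
  interpret prob_space "Pr i" by (rule prob_space_Pr)
  let ?F = "{\<omega>\<in>space (Pr i). \<forall>k\<le>n. \<Phi> k \<omega> = x k}"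
  let ?E = "{\<omega>\<in>space (Pr i). (\<forall>k\<le>n. \<Phi> k \<omega> = x k) \<and> \<Phi> (Suc n) \<omega> = l}"
  have "measure (Pr i) ?E = measure (Pr i) ?F * P (x n) l"
  proof (cases "0 < measure (Pr i) ?F")
    case True
    then have "\<P>(\<omega> in Pr i. \<Phi> (Suc n) \<omega> = l \<bar> \<forall>k\<le>n. \<Phi> k \<omega> = x k) = P (x n) l"
      using chain unfolding markov_chain_def by blast
    then have "measure (Pr i) {\<omega>\<in>space (Pr i). \<Phi> (Suc n) \<omega> = l \<and> (\<forall>k\<le>n. \<Phi> k \<omega> = x k)}
        = measure (Pr i) ?F * P (x n) l"
      using True by (auto simp: cond_prob_def field_simps)
    then show ?thesis by (simp add: conj_commute)
  next
    case False
    then have F: "measure (Pr i) ?F = 0"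
      using measure_nonneg[of "Pr i" ?F] by linarith
    have "measure (Pr i) ?E \<le> measure (Pr i) ?F"
      by (rule finite_measure_mono) auto
    then have "measure (Pr i) ?E = 0"
      using F measure_nonneg[of "Pr i" ?E] by linarith
    then show ?thesis using F by simp
  qed
  then show ?thesis
    by (simp add: emeasure_eq_measure ennreal_mult)
qed

text \<open>
  The Markov property is given only for complete histories. Induction on the number \<open>n\<close> of remaining steps, for an
  arbitrary prescribed history \<open>x 0, ..., x m\<close>, extends the history by its next state and so uses the left recursion by
  which the powers of the kernel are formed.
\<close>

lemma taboo_path_probability:
  "emeasure (Pr i) {\<omega>\<in>space (Pr i). (\<forall>k\<le>m. \<Phi> k \<omega> = x k) \<and>
      (\<forall>k. m < k \<and> k \<le> m + n \<longrightarrow> \<Phi> k \<omega> \<in> B) \<and> \<Phi> (m + n) \<omega> \<in> D}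
    = emeasure (Pr i) {\<omega>\<in>space (Pr i). \<forall>k\<le>m. \<Phi> k \<omega> = x k} * (kapp (taboo P B) ^^ n) (indicator D) (x m)"
proof (induction n arbitrary: m x)
  case 0
  have "{\<omega>\<in>space (Pr i). (\<forall>k\<le>m. \<Phi> k \<omega> = x k) \<and>
      (\<forall>k. m < k \<and> k \<le> m + 0 \<longrightarrow> \<Phi> k \<omega> \<in> B) \<and> \<Phi> (m + 0) \<omega> \<in> D}
      = (if x m \<in> D then {\<omega>\<in>space (Pr i). \<forall>k\<le>m. \<Phi> k \<omega> = x k} else {})"
    by auto
  then show ?case by (simp only: funpow_0) auto
next
  case (Suc n)
  let ?G = "\<lambda>l. {\<omega>\<in>space (Pr i). (\<forall>k\<le>Suc m. \<Phi> k \<omega> = (x(Suc m := l)) k) \<and>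
      (\<forall>k. Suc m < k \<and> k \<le> Suc m + n \<longrightarrow> \<Phi> k \<omega> \<in> B) \<and> \<Phi> (Suc m + n) \<omega> \<in> D}"
  have path: "(\<forall>k\<le>Suc m. \<Phi> k \<omega> = (x(Suc m := l)) k) \<longleftrightarrow> (\<forall>k\<le>m. \<Phi> k \<omega> = x k) \<and> \<Phi> (Suc m) \<omega> = l" for \<omega> l
    by (auto simp: le_Suc_eq)
  have "{\<omega>\<in>space (Pr i). (\<forall>k\<le>m. \<Phi> k \<omega> = x k) \<and>
      (\<forall>k. m < k \<and> k \<le> m + Suc n \<longrightarrow> \<Phi> k \<omega> \<in> B) \<and> \<Phi> (m + Suc n) \<omega> \<in> D} = (\<Union>l\<in>B. ?G l)"
  proof -
    have "(\<forall>k. m < k \<and> k \<le> m + Suc n \<longrightarrow> \<Phi> k \<omega> \<in> B) \<longleftrightarrow>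
        \<Phi> (Suc m) \<omega> \<in> B \<and> (\<forall>k. Suc m < k \<and> k \<le> Suc m + n \<longrightarrow> \<Phi> k \<omega> \<in> B)" for \<omega>
      by (metis Suc_lessI add_Suc_right add_Suc le_add1 lessI Suc_lessD)
    then show ?thesis unfolding path by auto
  qed
  moreover have "emeasure (Pr i) (\<Union>l\<in>B. ?G l) = (\<integral>\<^sup>+l. emeasure (Pr i) (?G l) \<partial>count_space B)"
  proof (rule emeasure_UN_countable)
    show "disjoint_family_on ?G B"
      unfolding path by (auto simp: disjoint_family_on_def)
  qed auto
  moreover have "emeasure (Pr i) (?G l)
      = emeasure (Pr i) {\<omega>\<in>space (Pr i). \<forall>k\<le>m. \<Phi> k \<omega> = x k} *
        (ennreal (P (x m) l) * (kapp (taboo P B) ^^ n) (indicator D) l)" for l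
    by (subst Suc) (simp only: path path_extend fun_upd_same mult.assoc)
  ultimately show ?case
    by (simp add: kapp_taboo[of P B "(kapp (taboo P B) ^^ n) (indicator D)"] nn_integral_cmult)
qed

lemma sets_return_time_gt [measurable]: "Measurable.pred (Pr i) (\<lambda>\<omega>. enat n < return_time \<Phi> \<alpha> \<omega>)"
  unfolding return_time_gt_iff by measurable

lemma before_return_probability:
  "emeasure (Pr i) {\<omega>\<in>space (Pr i). enat n < return_time \<Phi> \<alpha> \<omega> \<and> \<Phi> n \<omega> \<in> D}
    = (kapp (taboo P (- {\<alpha>})) ^^ n) (indicator D) i"
proof -
  interpret prob_space "Pr i" by (rule prob_space_Pr)
  have one: "emeasure (Pr i) {\<omega>\<in>space (Pr i). \<forall>k\<le>0. \<Phi> k \<omega> = i} = 1"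
    using starting_state[of i] by (intro emeasure_eq_1_AE) auto
  have "emeasure (Pr i) {\<omega>\<in>space (Pr i). enat n < return_time \<Phi> \<alpha> \<omega> \<and> \<Phi> n \<omega> \<in> D}
      = emeasure (Pr i) {\<omega>\<in>space (Pr i). (\<forall>k\<le>0. \<Phi> k \<omega> = i) \<and>
          (\<forall>k. 0 < k \<and> k \<le> 0 + n \<longrightarrow> \<Phi> k \<omega> \<in> - {\<alpha>}) \<and> \<Phi> (0 + n) \<omega> \<in> D}"
    using starting_state[of i] by (intro emeasure_eq_AE) (auto simp: return_time_gt_iff)
  also have "\<dots> = (kapp (taboo P (- {\<alpha>})) ^^ n) (indicator D) i"
    using taboo_path_probability[of i 0 "\<lambda>_. i" n "- {\<alpha>}" D] one by simp
  finally show ?thesis .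
qed

lemma nn_integral_before_return:
  "(\<integral>\<^sup>+\<omega>. (\<Sum>n. indicator {\<omega>. enat n < return_time \<Phi> \<alpha> \<omega> \<and> \<Phi> n \<omega> \<in> D} \<omega>) \<partial>Pr i)
    = potential (taboo P (- {\<alpha>})) (indicator D) i"
proof -
  have "(\<integral>\<^sup>+\<omega>. indicator {\<omega>. enat n < return_time \<Phi> \<alpha> \<omega> \<and> \<Phi> n \<omega> \<in> D} \<omega> \<partial>Pr i)
      = (kapp (taboo P (- {\<alpha>})) ^^ n) (indicator D) i" for n
  proof -
    have "(\<integral>\<^sup>+\<omega>. indicator {\<omega>. enat n < return_time \<Phi> \<alpha> \<omega> \<and> \<Phi> n \<omega> \<in> D} \<omega> \<partial>Pr i)
      = (\<integral>\<^sup>+\<omega>. indicator {\<omega>\<in>space (Pr i). enat n < return_time \<Phi> \<alpha> \<omega> \<and> \<Phi> n \<omega> \<in> D} \<omega> \<partial>Pr i)"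
      by (intro nn_integral_cong) (auto split: split_indicator)
    also have "\<dots> = emeasure (Pr i) {\<omega>\<in>space (Pr i). enat n < return_time \<Phi> \<alpha> \<omega> \<and> \<Phi> n \<omega> \<in> D}"
      by (intro nn_integral_indicator) simp
    finally show ?thesis by (simp add: before_return_probability)
  qed
  then show ?thesis
    unfolding potential_def by (subst nn_integral_suminf) auto
qed

lemma expected_return_time:
  "(\<integral>\<^sup>+\<omega>. ennreal_of_enat (return_time \<Phi> \<alpha> \<omega>) \<partial>Pr i) = potential (taboo P (- {\<alpha>})) (\<lambda>_. 1) i"
  unfolding ennreal_of_enat_return_time nn_integral_before_return by (simp add: indicator_def)

text \<open>
  The Lebesgue integral of the difference splits only because both the number of visits and the return time are integrable; the
  latter dominates the former.
\<close>

lemma integral_before_return: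
  assumes fin: "potential (taboo P (- {\<alpha>})) (\<lambda>_. 1) i < \<infinity>"
  shows "(\<integral>\<omega>. (\<Sum>k | enat k < return_time \<Phi> \<alpha> \<omega>. (of_bool (\<Phi> k \<omega> = j) - c)) \<partial>Pr i)
    = enn2real (potential (taboo P (- {\<alpha>})) (point j) i) - enn2real (potential (taboo P (- {\<alpha>})) (\<lambda>_. 1) i) * c"
proof -
  interpret prob_space "Pr i" by (rule prob_space_Pr)
  let ?I = "\<lambda>D n. indicator {\<omega>. enat n < return_time \<Phi> \<alpha> \<omega> \<and> \<Phi> n \<omega> \<in> D} :: 'w \<Rightarrow> ennreal"
  have [measurable]: "?I D n \<in> borel_measurable (Pr i)" for D n
    by (rule borel_measurable_indicator') measurable
  have finite_iff: "return_time \<Phi> \<alpha> \<omega> < \<infinity> \<longleftrightarrow> (\<exists>n. \<not> enat n < return_time \<Phi> \<alpha> \<omega>)" for \<omega>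
    by (cases "return_time \<Phi> \<alpha> \<omega>") auto
  have [measurable]: "Measurable.pred (Pr i) (\<lambda>\<omega>. return_time \<Phi> \<alpha> \<omega> < \<infinity>)"
    unfolding finite_iff by measurable
  have "AE \<omega> in Pr i. ennreal_of_enat (return_time \<Phi> \<alpha> \<omega>) \<noteq> \<infinity>"
  proof (rule nn_integral_PInf_AE)
    show "(\<lambda>\<omega>. ennreal_of_enat (return_time \<Phi> \<alpha> \<omega>)) \<in> borel_measurable (Pr i)"
      unfolding ennreal_of_enat_return_time by measurable
  qed (use fin in \<open>simp add: expected_return_time\<close>)
  then have ae: "AE \<omega> in Pr i. return_time \<Phi> \<alpha> \<omega> < \<infinity>"
  proof (rule AE_mp, intro AE_I2 impI)
    fix \<omega> assume "ennreal_of_enat (return_time \<Phi> \<alpha> \<omega>) \<noteq> \<infinity>"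
    then show "return_time \<Phi> \<alpha> \<omega> < \<infinity>" by (cases "return_time \<Phi> \<alpha> \<omega>") auto
  qed
  define S where "S D \<omega> = (\<Sum>k | enat k < return_time \<Phi> \<alpha> \<omega>. of_bool (\<Phi> k \<omega> \<in> D) :: real)" for D \<omega>
  have S_nonneg: "0 \<le> S D \<omega>" for D \<omega>
    by (simp add: S_def sum_nonneg)
  have S_eq: "S D = (\<lambda>\<omega>. if return_time \<Phi> \<alpha> \<omega> < \<infinity> then enn2real (\<Sum>n. ?I D n \<omega>) else 0)" for D
  proof
    fix \<omega>
    show "S D \<omega> = (if return_time \<Phi> \<alpha> \<omega> < \<infinity> then enn2real (\<Sum>n. ?I D n \<omega>) else 0)"
      using S_nonneg[of D \<omega>] by (simp add: sum_before_return S_def)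
  qed
  have S_meas [measurable]: "S D \<in> borel_measurable (Pr i)" for D
    unfolding S_eq by measurable
  have S: "has_bochner_integral (Pr i) (S D) (enn2real (potential (taboo P (- {\<alpha>})) (indicator D) i))" for D
  proof (rule has_bochner_integral_nn_integral)
    have "(\<integral>\<^sup>+\<omega>. ennreal (S D \<omega>) \<partial>Pr i) = potential (taboo P (- {\<alpha>})) (indicator D) i"
      unfolding nn_integral_before_return[symmetric]
      using ae by (intro nn_integral_cong_AE) (auto simp: S_def sum_before_return)
    moreover have "\<dots> < \<infinity>"
      by (rule order_le_less_trans[OF potential_mono fin]) (auto split: split_indicator)
    ultimately show "(\<integral>\<^sup>+\<omega>. ennreal (S D \<omega>) \<partial>Pr i) = ennreal (enn2real (potential (taboo P (- {\<alpha>})) (indicator D) i))"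
      by simp
  qed (auto simp: S_def sum_nonneg)
  have "has_bochner_integral (Pr i) (\<lambda>\<omega>. S {j} \<omega> - S UNIV \<omega> * c)
    (enn2real (potential (taboo P (- {\<alpha>})) (indicator {j}) i) - enn2real (potential (taboo P (- {\<alpha>})) (indicator UNIV) i) * c)"
    by (intro has_bochner_integral_diff has_bochner_integral_mult_left S)
  moreover have "(\<lambda>\<omega>. S {j} \<omega> - S UNIV \<omega> * c) = (\<lambda>\<omega>. \<Sum>k | enat k < return_time \<Phi> \<alpha> \<omega>. (of_bool (\<Phi> k \<omega> = j) - c))"
    by (simp add: S_def sum_subtractf)
  moreover have "indicator {j} = point j" "indicator UNIV = (\<lambda>_. 1::ennreal)"
    by (auto simp: indicator_def)
  ultimately show ?thesis
    by (simp add: has_bochner_integral_integral_eq)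
qed

end

section \<open>Group inverses of finite blocks\<close>

lemma mmult_finite: "finite A \<Longrightarrow> mmult A X Y i j = (\<Sum>l\<in>A. X i l * Y l j)"
  by (simp add: mmult_def)

lemma mmult_assoc: "finite A \<Longrightarrow> mmult A (mmult A X Y) Z = mmult A X (mmult A Y Z)"
  by (intro ext) (simp add: mmult_finite sum_distrib_left sum_distrib_right mult.assoc, rule sum.swap)

text \<open>
  The products with inner index set \<open>A\<close> are associative as functions on the whole type, but the identities for a group
  inverse are required on \<open>A\<close> alone. Setting \<open>W\<close> to zero off \<open>A\<close> turns them into equations
  between functions, to which matrix algebra applies directly.
\<close>

definition block :: "'a set \<Rightarrow> 'a mat \<Rightarrow> 'a mat" where
  "block A X = (\<lambda>i j. if i \<in> A \<and> j \<in> A then X i j else 0)"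

lemma is_group_inverse_block:
  assumes "finite A" "is_group_inverse A W G"
  shows "mmult A (mmult A (block A W) G) (block A W) = block A W"
    and "mmult A (mmult A G (block A W)) G = G"
    and "mmult A G (block A W) = mmult A (block A W) G"
proof -
  have G0: "G i j = 0" if "i \<notin> A \<or> j \<notin> A" for i j
    using assms that unfolding is_group_inverse_def by blast
  have 1: "mmult A (block A W) G i j = (if i \<in> A then mmult A W G i j else 0)" for i j
    using assms(1) by (simp add: mmult_finite block_def)
  have 2: "mmult A G (block A W) i j = (if j \<in> A then mmult A G W i j else 0)" for i j
    using assms(1) by (simp add: mmult_finite block_def)
  have 3: "mmult A W G i j = 0" if "j \<notin> A" for i j
    using assms(1) that by (simp add: mmult_finite G0)
  have 4: "mmult A G W i j = 0" if "i \<notin> A" for i j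
    using assms(1) that by (simp add: mmult_finite G0)
  have eqs: "mmult A (mmult A W G) W i j = W i j" "mmult A (mmult A G W) G i j = G i j"
      "mmult A G W i j = mmult A W G i j" if "i \<in> A" "j \<in> A" for i j
    using assms(2) that unfolding is_group_inverse_def by blast+
  show "mmult A G (block A W) = mmult A (block A W) G"
    by (intro ext) (auto simp: 1 2 3 4 eqs)
  show "mmult A (mmult A G (block A W)) G = G"
  proof (intro ext)
    fix i j
    show "mmult A (mmult A G (block A W)) G i j = G i j"
    proof (cases "i \<in> A \<and> j \<in> A")
      case True
      then show ?thesis
        using eqs(2)[of i j] assms(1) by (simp add: mmult_finite[of A _ G] 2)
    next
      case False
      then show ?thesis
        using assms(1) by (auto simp: mmult_finite[of A _ G] 2 4 G0)
    qed
  qed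
  have 5: "mmult A (mmult A (block A W) G) (block A W) i j
      = (\<Sum>l\<in>A. (if i \<in> A then mmult A W G i l else 0) * block A W l j)" for i j
    by (simp only: mmult_finite[OF assms(1), of _ "block A W"] 1)
  show "mmult A (mmult A (block A W) G) (block A W) = block A W"
  proof (intro ext)
    fix i j
    show "mmult A (mmult A (block A W) G) (block A W) i j = block A W i j"
      using eqs(1)[of i j] unfolding 5 mmult_finite[OF assms(1), of _ W]
      by (auto simp: block_def)
  qed
qed

text \<open>
  Both \<open>G V\<close> and \<open>H V\<close> are equal to the same projection: \<open>G V = G V H V = V G V H = V H\<close>.
  Hence \<open>G = G V G = H V G = H V H = H\<close>.
\<close>

lemma group_inverse_unique:
  assumes "finite A" "is_group_inverse A W G" "is_group_inverse A W H"
  shows "G = H"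
proof -
  define V where "V = block A W"
  note mult = mmult_assoc[OF assms(1)]
  note g = is_group_inverse_block[OF assms(1,2), folded V_def]
  note h = is_group_inverse_block[OF assms(1,3), folded V_def]
  have "mmult A G V = mmult A G (mmult A (mmult A V H) V)" using h(1) by simp
  also have "\<dots> = mmult A (mmult A G V) (mmult A H V)" by (simp add: mult)
  also have "\<dots> = mmult A (mmult A V G) (mmult A V H)" by (simp only: g(3) h(3))
  also have "\<dots> = mmult A (mmult A (mmult A V G) V) H" by (simp add: mult)
  finally have E: "mmult A G V = mmult A V H" by (simp only: g(1))
  have "G = mmult A (mmult A V H) G" using g(2) E by simp
  also have "\<dots> = mmult A H (mmult A V G)" by (simp only: h(3)[symmetric] mult)
  also have "\<dots> = mmult A (mmult A H V) H" by (simp only: g(3)[symmetric] E mult)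
  finally show ?thesis by (simp only: h(2))
qed

lemma group_inverse_is_group_inverse:
  assumes "finite A" "is_group_inverse A W G"
  shows "is_group_inverse A W (group_inverse A W)"
  unfolding group_inverse_def
  by (rule theI[where P="is_group_inverse A W", OF assms(2)], erule group_inverse_unique[OF assms(1) _ assms(2)])

lemma sum_times_delta:
  fixes f :: "'a \<Rightarrow> real"
  assumes "finite A" "j \<in> A"
  shows "(\<Sum>l\<in>A. f l * of_bool (l = j)) = f j" "(\<Sum>l\<in>A. of_bool (j = l) * f l) = f j"
proof -
  have "(\<Sum>l\<in>A. f l * of_bool (l = j)) = (\<Sum>l\<in>A. if l = j then f l else 0)"
    by (intro sum.cong) auto
  then show "(\<Sum>l\<in>A. f l * of_bool (l = j)) = f j"
    using assms by simp
  have "(\<Sum>l\<in>A. of_bool (j = l) * f l) = (\<Sum>l\<in>A. if l = j then f l else 0)"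
    by (intro sum.cong) auto
  then show "(\<Sum>l\<in>A. of_bool (j = l) * f l) = f j"
    using assms by simp
qed

text \<open>
  Let \<open>\<Pi>\<close> be the matrix all of whose rows are \<open>\<nu>\<close>, the normalization of \<open>p\<close>. The
  hypothesis on \<open>Z\<close> says \<open>W Z = I - m p\<^sup>T\<close>. Then \<open>Y = Z (I - \<Pi>)\<close> satisfies
  \<open>W Y = I - \<Pi>\<close>, since \<open>m p\<^sup>T \<Pi> = m p\<^sup>T\<close>, and the group inverse is
  \<open>G = (I - \<Pi>) Y\<close>. Indeed \<open>W G = I - \<Pi>\<close> and \<open>\<Pi> G = 0\<close>. To see that
  \<open>G W\<close> is the same projection, note that \<open>W (G W - I) = (I - \<Pi>) W - W = 0\<close>, so the columns of
  \<open>G W - I\<close> are constant, and \<open>\<Pi> (G W - I) = - \<Pi>\<close> determines the constants.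
\<close>

lemma group_inverse_exists:
  fixes W Z :: "'a mat" and p m :: "'a \<Rightarrow> real"
  assumes "finite A"
    and row: "\<And>i. i \<in> A \<Longrightarrow> (\<Sum>l\<in>A. W i l) = 0"
    and col: "\<And>j. j \<in> A \<Longrightarrow> (\<Sum>l\<in>A. p l * W l j) = 0"
    and mass: "(\<Sum>l\<in>A. p l) \<noteq> 0"
    and kernel: "\<And>v i j. (\<And>i. i \<in> A \<Longrightarrow> (\<Sum>l\<in>A. W i l * v l) = 0) \<Longrightarrow> i \<in> A \<Longrightarrow> j \<in> A \<Longrightarrow> v i = v j"
    and Z: "\<And>i j. i \<in> A \<Longrightarrow> j \<in> A \<Longrightarrow> (\<Sum>l\<in>A. W i l * Z l j) = of_bool (i = j) - m i * p j"
  shows "\<exists>G. is_group_inverse A W G"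
proof -
  define s where "s = (\<Sum>l\<in>A. p l)"
  define \<nu> where "\<nu> j = p j / s" for j
  have \<nu>1: "(\<Sum>l\<in>A. \<nu> l) = 1" and col': "\<And>j. j \<in> A \<Longrightarrow> (\<Sum>l\<in>A. \<nu> l * W l j) = 0"
    using mass col by (simp_all add: \<nu>_def s_def flip: sum_divide_distrib)
  have p: "p j = s * \<nu> j" for j using mass by (simp add: \<nu>_def s_def)
  define Y where "Y i j = Z i j - (\<Sum>l\<in>A. Z i l) * \<nu> j" for i j
  have WY: "(\<Sum>l\<in>A. W i l * Y l j) = of_bool (i = j) - \<nu> j" if "i \<in> A" "j \<in> A" for i j
  proof -
    have "(\<Sum>l\<in>A. W i l * Y l j) = (\<Sum>l\<in>A. W i l * Z l j) - (\<Sum>l\<in>A. \<Sum>k\<in>A. W i l * Z l k) * \<nu> j"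
      by (simp add: Y_def algebra_simps sum_subtractf sum_distrib_left sum_distrib_right)
    also have "(\<Sum>l\<in>A. \<Sum>k\<in>A. W i l * Z l k) = (\<Sum>k\<in>A. of_bool (i = k) - m i * p k)"
      by (subst sum.swap) (simp add: Z that)
    also have "\<dots> = 1 - m i * s"
      using that assms(1) by (simp add: sum_subtractf s_def of_bool_def flip: sum_distrib_left)
    finally show ?thesis using that by (simp add: Z p algebra_simps)
  qed
  define G where "G i j = (if i \<in> A \<and> j \<in> A then Y i j - (\<Sum>k\<in>A. \<nu> k * Y k j) else 0)" for i j
  have \<nu>G: "(\<Sum>l\<in>A. \<nu> l * G l j) = 0" if "j \<in> A" for j
    using that by (simp add: G_def algebra_simps sum_subtractf \<nu>1 flip: sum_distrib_right sum_distrib_left)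
  have WG: "(\<Sum>l\<in>A. W i l * G l j) = of_bool (i = j) - \<nu> j" if "i \<in> A" "j \<in> A" for i j
  proof -
    define c where "c = (\<Sum>k\<in>A. \<nu> k * Y k j)"
    have "(\<Sum>l\<in>A. W i l * G l j) = (\<Sum>l\<in>A. W i l * Y l j) - (\<Sum>l\<in>A. W i l) * c"
      using that by (simp add: G_def algebra_simps sum_subtractf sum_distrib_left flip: c_def)
    then show ?thesis using that by (simp add: WY row)
  qed
  have Y1: "(\<Sum>l\<in>A. Y i l) = 0" for i
    by (simp add: Y_def sum_subtractf \<nu>1 flip: sum_distrib_left)
  have G1: "(\<Sum>l\<in>A. G i l) = 0" for i
  proof -
    have "(\<Sum>l\<in>A. \<Sum>k\<in>A. \<nu> k * Y k l) = 0"
      by (subst sum.swap) (simp add: Y1 flip: sum_distrib_left)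
    then show ?thesis by (cases "i \<in> A") (simp_all add: G_def sum_subtractf Y1)
  qed
  have GW: "(\<Sum>l\<in>A. G i l * W l j) = of_bool (i = j) - \<nu> j" if "i \<in> A" "j \<in> A" for i j
  proof -
    \<comment> \<open>the \<open>j\<close>-th column of \<open>G W - I\<close>, which lies in the kernel of \<open>W\<close>\<close>
    define v where "v i = (\<Sum>l\<in>A. G i l * W l j) - of_bool (i = j)" for i
    have "(\<Sum>l\<in>A. W i l * v l) = 0" if "i \<in> A" for i
    proof -
      have "(\<Sum>l\<in>A. W i l * v l) = (\<Sum>l\<in>A. \<Sum>k\<in>A. W i l * G l k * W k j) - W i j"
        by (simp only: v_def right_diff_distrib sum_subtractf sum_distrib_left mult.assoc
            sum_times_delta[OF assms(1) \<open>j \<in> A\<close>])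
      also have "(\<Sum>l\<in>A. \<Sum>k\<in>A. W i l * G l k * W k j) = (\<Sum>k\<in>A. (of_bool (i = k) - \<nu> k) * W k j)"
        by (subst sum.swap) (simp add: WG that flip: sum_distrib_right)
      also have "\<dots> = W i j"
        by (simp only: left_diff_distrib sum_subtractf col'[OF \<open>j \<in> A\<close>]
            sum_times_delta[OF assms(1) that] diff_0_right)
      finally show ?thesis by simp
    qed
    then have const: "v k = v i" if "k \<in> A" for k
      using kernel[of v] that \<open>i \<in> A\<close> by blast
    have "(\<Sum>k\<in>A. \<nu> k * v k) = (\<Sum>k\<in>A. \<Sum>l\<in>A. \<nu> k * G k l * W l j) - \<nu> j"
      by (simp only: v_def right_diff_distrib sum_subtractf sum_distrib_left mult.assoc
          sum_times_delta[OF assms(1) \<open>j \<in> A\<close>])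
    also have "(\<Sum>k\<in>A. \<Sum>l\<in>A. \<nu> k * G k l * W l j) = 0"
      by (subst sum.swap) (simp add: \<nu>G flip: sum_distrib_right)
    also have "(\<Sum>k\<in>A. \<nu> k * v k) = (\<Sum>k\<in>A. \<nu> k) * v i"
      unfolding sum_distrib_right by (intro sum.cong) (use const in auto)
    finally show ?thesis by (simp add: \<nu>1 v_def)
  qed
  have "is_group_inverse A W G"
    unfolding is_group_inverse_def
  proof (intro conjI ballI allI impI)
    fix i j assume ij: "i \<in> A" "j \<in> A"
    show "mmult A (mmult A W G) W i j = W i j"
      by (simp add: mmult_finite assms(1) ij WG left_diff_distrib sum_subtractf col'
          sum_times_delta[OF assms(1) ij(1)])
    show "mmult A (mmult A G W) G i j = G i j"
      by (simp add: mmult_finite assms(1) ij GW left_diff_distrib sum_subtractf \<nu>G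
          sum_times_delta[OF assms(1) ij(1)])
    show "mmult A G W i j = mmult A W G i j"
      using ij assms(1) by (simp add: mmult_finite GW WG)
  qed (auto simp: G_def)
  then show ?thesis by blast
qed

section \<open>Censoring on a finite set\<close>

locale censoring = transition_matrix P
  for P :: "'a::countable \<Rightarrow> 'a \<Rightarrow> real" +
  fixes A :: "'a set" and \<alpha> :: 'a and \<pi> :: "'a \<Rightarrow> real"
  assumes irreducible: "irreducible_matrix P"
    and finite_A: "finite A" and \<alpha>_in_A: "\<alpha> \<in> A"
    and finite_mean_return: "potential (taboo P (- {\<alpha>})) (\<lambda>_. 1) \<alpha> < \<infinity>"
    and invariant: "invariant_probability_vector P \<pi>"
begin

abbreviation U where "U \<equiv> potential (taboo P (- A))"
abbreviation V where "V \<equiv> potential (taboo P (- {\<alpha>}))"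

text \<open>
  With \<open>\<sigma> \<ge> 1\<close> the first time in \<open>A\<close> after time zero, \<open>Q i l\<close> is the probability
  of entering \<open>A\<close> at \<open>l\<close>, \<open>N i j\<close> the expected number of visits to \<open>j\<close> in
  \<open>[0, \<sigma>)\<close>, and \<open>m i\<close> the expectation of \<open>\<sigma>\<close>. The matrix
  \<open>deviation\<close> is the one whose expression as an expectation over a cycle is computed in
  \<open>integral_before_return\<close>.
\<close>

definition Q where "Q i l = enn2real (hitting (- A) i l)"
definition N where "N i j = enn2real (U (point j) i)"
definition m where "m i = enn2real (U (\<lambda>_. 1) i)"
definition deviation where "deviation i j = enn2real (V (point j) i) - enn2real (V (\<lambda>_. 1) i) * \<pi> j"

lemma V_finite: "(\<And>l. v l \<le> 1) \<Longrightarrow> V v i < \<infinity>"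
  using finite_return_time_everywhere[OF irreducible finite_mean_return, of i]
  by (rule order_le_less_trans[rotated]) (intro potential_mono, auto)

lemma U_finite:
  assumes "\<And>l. v l \<le> 1"
  shows "U v i < \<infinity>"
proof (rule order_le_less_trans[OF _ V_finite[OF assms]])
  show "U v i \<le> V v i"
    by (intro potential_mono) (use \<alpha>_in_A in \<open>auto simp: taboo_def split: split_indicator\<close>)
qed

lemma ennreal_Q: "ennreal (Q i l) = hitting (- A) i l"
  using U_finite[of "\<lambda>i. ennreal (P i l)" i] P_le_1 by (simp add: Q_def hitting_def)

lemma ennreal_N: "ennreal (N i j) = U (point j) i"
  using U_finite[of "point j" i] by (simp add: N_def)

lemma Q_nonneg: "0 \<le> Q i l" and N_nonneg: "0 \<le> N i j"
  by (simp_all add: Q_def N_def)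

lemma P_hat_eq_N: "P_hat (- A) P i j = N i j"
  using U_finite[of "point j" i] by (simp add: P_hat_eq N_def)

lemma N_column_in_A: "j \<in> A \<Longrightarrow> N i j = of_bool (i = j)"
  by (simp add: N_def potential_point_outside)

lemma Q_sum: "(\<Sum>l\<in>A. Q i l) = 1"
proof -
  have "ennreal (\<Sum>l\<in>A. Q i l) = 1"
    using hitting_sum[OF finite_A U_finite, of i] by (simp add: Q_nonneg flip: sum_ennreal ennreal_Q)
  then show ?thesis by simp
qed

lemma mmult_P_P_hat: "mmult (- A) P (P_hat (- A) P) i j = enn2real (kapp (taboo P (- A)) (U (point j)) i)"
  and kapp_U_finite: "kapp (taboo P (- A)) (U (point j)) i < \<infinity>"
proof -
  show fin: "kapp (taboo P (- A)) (U (point j)) i < \<infinity>"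
    by (rule order_le_less_trans[OF kapp_potential_le]) (rule U_finite, simp)
  show "mmult (- A) P (P_hat (- A) P) i j = enn2real (kapp (taboo P (- A)) (U (point j)) i)"
    by (rule mmult_eq_enn2real[OF _ _ _ fin]) (simp_all add: P_hat_eq_N N_nonneg ennreal_N kapp_taboo)
qed

text \<open>
  Matrix products of blocks sum over \<open>- A\<close>, whereas a potential is a superposition over all states. The two agree when
  the row is outside \<open>A\<close>, because the columns in \<open>A\<close> are never visited. The subsequent lemma has one more
  step in front, which leads outside \<open>A\<close> and makes this argument apply to every row.
\<close>

lemma integral_potential_off_A:
  assumes "i \<notin> A"
  shows "(\<integral>\<^sup>+l. U (point l) i * v l \<partial>count_space (- A)) = U v i"
proof -
  have "(\<integral>\<^sup>+l. U (point l) i * v l \<partial>count_space (- A)) = (\<integral>\<^sup>+l. U (point l) i * v l \<partial>count_space UNIV)"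
    by (subst nn_integral_count_space_indicator)
      (use assms in \<open>auto intro!: nn_integral_cong simp: potential_point_outside split: split_indicator\<close>)
  then show ?thesis by (simp flip: potential_integral)
qed

lemma integral_kapp_potential_off_A:
  "(\<integral>\<^sup>+l. kapp (taboo P (- A)) (U (point l)) i * v l \<partial>count_space (- A)) = kapp (taboo P (- A)) (U v) i"
proof -
  have "(\<integral>\<^sup>+l. kapp (taboo P (- A)) (U (point l)) i * v l \<partial>count_space (- A))
      = (\<integral>\<^sup>+l. (\<integral>\<^sup>+k. ennreal (P i k) * (U (point l) k * v l) \<partial>count_space (- A)) \<partial>count_space (- A))"
    by (simp add: kapp_taboo mult.assoc flip: nn_integral_multc)
  also have "\<dots> = (\<integral>\<^sup>+k. (\<integral>\<^sup>+l. ennreal (P i k) * (U (point l) k * v l) \<partial>count_space (- A)) \<partial>count_space (- A))"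
    by (rule nn_integral_count_space_nn_integral) auto
  also have "\<dots> = (\<integral>\<^sup>+k. ennreal (P i k) * U v k \<partial>count_space (- A))"
    by (intro nn_integral_cong) (simp add: nn_integral_cmult integral_potential_off_A)
  finally show ?thesis by (simp add: kapp_taboo)
qed

text \<open>
  The chain censored on \<open>A\<close> moves according to the first entrance: directly with \<open>P\<close>, or after a step
  outside \<open>A\<close> and an excursion there.
\<close>

lemma censored_eq_Q: "censored A P i j = Q i j"
proof -
  have fin: "kapp (taboo P (- A)) (\<lambda>i. hitting (- A) i j) i < \<infinity>"
  proof (rule order_le_less_trans)
    show "kapp (taboo P (- A)) (\<lambda>i. hitting (- A) i j) i \<le> hitting (- A) i j"
      by (subst (2) hitting_unfold) simp
  qed (simp flip: ennreal_Q)
  have "mmult (- A) (mmult (- A) P (P_hat (- A) P)) P i j = enn2real (kapp (taboo P (- A)) (\<lambda>i. hitting (- A) i j) i)"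
  proof (rule mmult_eq_enn2real[OF _ _ _ fin])
    have "ennreal (mmult (- A) P (P_hat (- A) P) i l) = kapp (taboo P (- A)) (U (point l)) i" for l
      using kapp_U_finite[of l i] by (simp add: mmult_P_P_hat)
    then show "(\<integral>\<^sup>+l. ennreal (mmult (- A) P (P_hat (- A) P) i l) * ennreal (P l j) \<partial>count_space (- A))
        = kapp (taboo P (- A)) (\<lambda>i. hitting (- A) i j) i"
      by (simp add: integral_kapp_potential_off_A hitting_def[abs_def])
  qed (simp_all add: mmult_P_P_hat)
  then show ?thesis
    unfolding censored_def Q_def hitting_unfold[of "- A" i j]
    using fin by (simp add: enn2real_plus)
qed

lemma mmult_P_hat_P: "i \<notin> A \<Longrightarrow> mmult (- A) (P_hat (- A) P) P i j = Q i j"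
  unfolding Q_def
  by (rule mmult_eq_enn2real)
    (simp_all add: P_hat_eq_N N_nonneg ennreal_N integral_potential_off_A hitting_def ennreal_Q[symmetric, unfolded hitting_def])

lemma first_block_row: "i \<in> A \<Longrightarrow> (if j \<in> A then mone i j else mmult (- A) P (P_hat (- A) P) i j) = N i j"
proof (cases "j \<in> A")
  case True
  then show ?thesis by (simp add: N_column_in_A mone_def)
next
  case False
  moreover assume "i \<in> A"
  ultimately have "i \<noteq> j" by auto
  then have "U (point j) i = kapp (taboo P (- A)) (U (point j)) i"
    by (subst potential_unfold) simp
  then show ?thesis using False by (simp add: mmult_P_P_hat N_def)
qed

lemma first_block_row_sum: "1 + (\<Sum>\<^sub>\<infinity>l\<in>- A. mmult (- A) P (P_hat (- A) P) i l) = m i"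
proof -
  have fin: "kapp (taboo P (- A)) (U (\<lambda>_. 1)) i < \<infinity>"
    by (rule order_le_less_trans[OF kapp_potential_le]) (rule U_finite, simp)
  have "(\<Sum>\<^sub>\<infinity>l\<in>- A. mmult (- A) P (P_hat (- A) P) i l) = enn2real (kapp (taboo P (- A)) (U (\<lambda>_. 1)) i)"
  proof (rule infsum_eq_enn2real[OF _ _ fin])
    have "ennreal (mmult (- A) P (P_hat (- A) P) i l) = kapp (taboo P (- A)) (U (point l)) i" for l
      using kapp_U_finite[of l i] by (simp add: mmult_P_P_hat)
    then show "(\<integral>\<^sup>+l. ennreal (mmult (- A) P (P_hat (- A) P) i l) \<partial>count_space (- A))
        = kapp (taboo P (- A)) (U (\<lambda>_. 1)) i"
      using integral_kapp_potential_off_A[of i "\<lambda>_. 1"] by simp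
  qed (simp add: mmult_P_P_hat)
  then show ?thesis
    unfolding m_def potential_unfold[of _ _ i] using fin by (simp add: enn2real_plus)
qed

lemma second_block_row: "i \<notin> A \<Longrightarrow> (if j \<in> A then 0 else P_hat (- A) P i j) = N i j"
  by (auto simp: P_hat_eq_N N_column_in_A)

lemma second_block_row_sum:
  assumes "i \<notin> A"
  shows "(\<Sum>\<^sub>\<infinity>l\<in>- A. P_hat (- A) P i l) = m i"
  unfolding m_def
proof (rule infsum_eq_enn2real)
  show "(\<integral>\<^sup>+l. ennreal (P_hat (- A) P i l) \<partial>count_space (- A)) = U (\<lambda>_. 1) i"
    using integral_potential_off_A[OF assms, of "\<lambda>_. 1"] by (simp add: P_hat_eq_N ennreal_N)
qed (use U_finite[of "\<lambda>_. 1" i] in \<open>simp_all add: P_hat_eq_N N_nonneg\<close>)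

lemma pi_nonneg: "0 \<le> \<pi> j"
  using invariant by (simp add: invariant_probability_vector_def)

lemma pi_mass: "(\<integral>\<^sup>+i. ennreal (\<pi> i) \<partial>count_space UNIV) = 1"
  using invariant has_sum_iff_nn_integral_count_space[of UNIV \<pi> 1]
  by (simp add: invariant_probability_vector_def)

lemma pi_invariant: "(\<integral>\<^sup>+i. ennreal (\<pi> i) * ennreal (P i j) \<partial>count_space UNIV) = ennreal (\<pi> j)"
  using invariant has_sum_iff_nn_integral_count_space[of UNIV "\<lambda>i. \<pi> i * P i j" "\<pi> j"]
  by (simp add: invariant_probability_vector_def ennreal_mult)

text \<open>
  Used with \<open>F = A\<close> for the censored chain and with \<open>F = {\<alpha>}\<close> for the cycles between returns to
  \<open>\<alpha>\<close>.
\<close>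

lemma pi_cycle_formula:
  assumes "finite F" "\<alpha> \<in> F" "\<And>i. v i \<le> 1"
  shows "(\<integral>\<^sup>+i. ennreal (\<pi> i) * v i \<partial>count_space UNIV)
    = (\<Sum>i\<in>F. ennreal (\<pi> i) * potential (taboo P (- F)) v i)"
proof (rule invariant_integral[OF assms(1) _ pi_invariant _ assms(3)])
  fix i
  have "potential (taboo P (- F)) (\<lambda>_. 1) i \<le> V (\<lambda>_. 1) i"
    by (intro potential_mono) (use assms(2) in \<open>auto simp: taboo_def split: split_indicator\<close>)
  then show "potential (taboo P (- F)) (\<lambda>_. 1) i < \<infinity>"
    by (rule order_le_less_trans) (rule V_finite, simp)
qed (simp add: pi_mass)

lemma integral_point: "(\<integral>\<^sup>+i. f i * point j i \<partial>count_space UNIV) = f j" for f :: "'a \<Rightarrow> ennreal"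
proof -
  have "(\<integral>\<^sup>+i. f i * point j i \<partial>count_space UNIV) = (\<integral>\<^sup>+i. f i * indicator {j} i \<partial>count_space UNIV)"
    by (intro nn_integral_cong) (auto split: split_indicator)
  then show ?thesis by simp
qed

text \<open>
  On \<open>A\<close> this is the invariance of \<open>\<pi>\<close> under the censored matrix. It is the cycle formula for the
  function \<open>P(\<cdot>,j)\<close>, whose integral against \<open>\<pi>\<close> is \<open>\<pi> j\<close>.
\<close>

lemma pi_Q: "(\<Sum>i\<in>A. \<pi> i * Q i j) = \<pi> j"
proof -
  have "ennreal (\<pi> j) = (\<Sum>i\<in>A. ennreal (\<pi> i) * hitting (- A) i j)"
    using pi_cycle_formula[OF finite_A \<alpha>_in_A, of "\<lambda>i. ennreal (P i j)"] P_le_1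
    by (simp add: pi_invariant hitting_def)
  also have "\<dots> = ennreal (\<Sum>i\<in>A. \<pi> i * Q i j)"
    by (simp add: pi_nonneg Q_nonneg ennreal_mult flip: ennreal_Q sum_ennreal)
  finally show ?thesis
    by (simp add: pi_nonneg Q_nonneg sum_nonneg)
qed

lemma pi_A_nonzero: "(\<Sum>i\<in>A. \<pi> i) \<noteq> 0"
proof
  assume "(\<Sum>i\<in>A. \<pi> i) = 0"
  then have "\<pi> i = 0" if "i \<in> A" for i
    using that finite_A pi_nonneg by (simp add: sum_nonneg_eq_0_iff)
  then show False
    using pi_cycle_formula[OF finite_A \<alpha>_in_A, of "\<lambda>_. 1"] by (simp add: pi_mass)
qed

text \<open>
  The cycle formula at the single state \<open>\<alpha>\<close>, for the indicator of \<open>j\<close> and for \<open>1\<close>,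
  reads \<open>\<pi> j = \<pi> \<alpha> * V (point j) \<alpha>\<close> and
  \<open>1 = \<pi> \<alpha> * V (\<lambda>_. 1) \<alpha>\<close>; eliminating \<open>\<pi> \<alpha>\<close> gives the claim.
\<close>

lemma deviation_alpha: "deviation \<alpha> j = 0"
proof -
  have "ennreal (\<pi> j) = ennreal (\<pi> \<alpha>) * V (point j) \<alpha>"
    using pi_cycle_formula[of "{\<alpha>}" "point j"] by (simp add: integral_point)
  then have "ennreal (\<pi> j) * V (\<lambda>_. 1) \<alpha> = (ennreal (\<pi> \<alpha>) * V (\<lambda>_. 1) \<alpha>) * V (point j) \<alpha>"
    by (simp add: mult_ac)
  also have "ennreal (\<pi> \<alpha>) * V (\<lambda>_. 1) \<alpha> = 1"
    using pi_cycle_formula[of "{\<alpha>}" "\<lambda>_. 1"] by (simp add: pi_mass)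
  finally have "enn2real (ennreal (\<pi> j) * V (\<lambda>_. 1) \<alpha>) = enn2real (V (point j) \<alpha>)"
    by simp
  then show ?thesis
    by (simp add: deviation_def enn2real_mult pi_nonneg mult.commute)
qed

lemma V_first_entrance:
  assumes "\<And>l. v l \<le> 1"
  shows "enn2real (V v i) = enn2real (U v i) + (\<Sum>l\<in>A - {\<alpha>}. Q i l * enn2real (V v l))"
proof -
  have *: "- A \<union> (A - {\<alpha>}) = - {\<alpha>}" using \<alpha>_in_A by auto
  have fin: "V v l = ennreal (enn2real (V v l))" "U v l = ennreal (enn2real (U v l))" for l
    using V_finite[of v l, OF assms] U_finite[of v l, OF assms] by simp_all
  have "V v i = U v i + (\<Sum>l\<in>A - {\<alpha>}. hitting (- A) i l * V v l)"
    using potential_first_entrance[of "A - {\<alpha>}" "- A" v i] finite_A V_finite[of v i, OF assms] unfolding * by auto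
  also have "\<dots> = ennreal (enn2real (U v i)) + (\<Sum>l\<in>A - {\<alpha>}. ennreal (Q i l) * ennreal (enn2real (V v l)))"
    unfolding fin(1)[symmetric] fin(2)[symmetric] ennreal_Q ..
  also have "\<dots> = ennreal (enn2real (U v i) + (\<Sum>l\<in>A - {\<alpha>}. Q i l * enn2real (V v l)))"
    by (simp add: Q_nonneg sum_nonneg flip: ennreal_mult ennreal_plus)
  finally show ?thesis
    by (simp add: Q_nonneg sum_nonneg del: ennreal_plus)
qed

text \<open>
  First entrance into \<open>A - {\<alpha>}\<close>, for the number of visits and for the duration. The sum extends to all of
  \<open>A\<close> since the row \<open>\<alpha>\<close> of the deviation vanishes.
\<close>

lemma deviation_equation:
  "deviation i j = (\<Sum>l\<in>A. Q i l * deviation l j) + N i j - m i * \<pi> j"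
proof -
  have visits: "enn2real (V (point j) i) = N i j + (\<Sum>l\<in>A - {\<alpha>}. Q i l * enn2real (V (point j) l))"
    unfolding N_def by (rule V_first_entrance) simp
  have time: "enn2real (V (\<lambda>_. 1) i) = m i + (\<Sum>l\<in>A - {\<alpha>}. Q i l * enn2real (V (\<lambda>_. 1) l))"
    unfolding m_def by (rule V_first_entrance) simp
  have "deviation i j = (\<Sum>l\<in>A - {\<alpha>}. Q i l * deviation l j) + N i j - m i * \<pi> j"
    unfolding deviation_def visits time
    by (simp add: algebra_simps sum_subtractf sum_distrib_left)
  then show ?thesis
    using finite_A \<alpha>_in_A by (simp add: sum.remove[of A \<alpha>] deviation_alpha)
qed

text \<open>
  A maximum principle. With \<open>M\<close> the maximum of \<open>v\<close> on \<open>A\<close>, the nonnegative function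
  \<open>M - v\<close> on \<open>A\<close> is extended to all states by averaging over the entrance into \<open>A\<close>. The
  extension is harmonic for \<open>P\<close> and vanishes at a state where the maximum is attained, hence everywhere by
  irreducibility.
\<close>

lemma harmonic_constant:
  assumes harm: "\<And>i. i \<in> A \<Longrightarrow> v i = (\<Sum>l\<in>A. Q i l * v l)" and "i \<in> A" "j \<in> A"
  shows "v i = v j"
proof -
  define M where "M = Max (v ` A)"
  have le: "v l \<le> M" if "l \<in> A" for l
    using that finite_A by (simp add: M_def)
  obtain a where a: "a \<in> A" "v a = M"
    using Max_in[of "v ` A"] finite_A \<open>i \<in> A\<close> unfolding M_def by fastforce
  define r where "r i = (\<Sum>l\<in>A. ennreal (P i l) * ennreal (M - v l))" for i
  have w: "U r i = (\<Sum>l\<in>A. hitting (- A) i l * ennreal (M - v l))" for i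
    using finite_A by (simp add: r_def[abs_def] potential_sum potential_cmult hitting_def)
  \<comment> \<open>\<open>U r\<close> extends \<open>M - v\<close>, since \<open>v\<close> is harmonic and the rows of \<open>Q\<close> have sum one\<close>
  have wA: "U r i = ennreal (M - v i)" if "i \<in> A" for i
  proof -
    have "U r i = ennreal (\<Sum>l\<in>A. Q i l * (M - v l))"
      by (simp add: w le Q_nonneg ennreal_mult flip: ennreal_Q sum_ennreal)
    also have "(\<Sum>l\<in>A. Q i l * (M - v l)) = M - v i"
      using harm[OF that] by (simp add: right_diff_distrib sum_subtractf Q_sum flip: sum_distrib_right)
    finally show ?thesis .
  qed
  have "U r i = (\<integral>\<^sup>+l. ennreal (P i l) * U r l \<partial>count_space UNIV)" for i
  proof -
    have "r i = (\<Sum>l\<in>A. ennreal (P i l) * U r l)"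
      by (simp add: r_def wA)
    then have "U r i = (\<Sum>l\<in>A. ennreal (P i l) * U r l) + kapp (taboo P (- A)) (U r) i"
      by (metis potential_unfold)
    also have "\<dots> = kapp (taboo P (- A \<union> A)) (U r) i"
      using finite_A by (subst split_finite_columns) auto
    finally show ?thesis by (simp add: kapp_taboo)
  qed
  then have "U r k = 0" for k
    by (rule harmonic_zero[OF irreducible, where a=a]) (simp add: wA a)
  then have "v k = M" if "k \<in> A" for k
    using wA[OF that] le[OF that] by (simp add: ennreal_eq_0_iff)
  then show ?thesis using assms by simp
qed

text \<open>
  On \<open>A\<close>, both the deviation and \<open>X_A\<close> solve \<open>W Y = R\<close>, the latter by
  \<open>W W\<^sup># W = W\<close>, so they differ by functions that are harmonic for the censored chain and therefore constant in
  the row index. Off \<open>A\<close> the equation through \<open>Q\<close> carries the same constants over.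
\<close>

lemma deviation_eq_X_tilde: "deviation i j = X_tilde A P \<pi> i j - X_tilde A P \<pi> \<alpha> j"
proof -
  define W where "W = (\<lambda>i j. mone i j - censored A P i j)"
  define R where "R = (\<lambda>i j. N i j - m i * \<pi> j)"
  define G where "G = group_inverse A W"
  have W_apply: "(\<Sum>l\<in>A. W i l * v l) = v i - (\<Sum>l\<in>A. Q i l * v l)" if "i \<in> A" for i v
    using sum_times_delta(2)[OF finite_A that, of v]
    by (simp add: W_def mone_def censored_eq_Q left_diff_distrib sum_subtractf of_bool_def)
  have WK: "(\<Sum>l\<in>A. W i l * deviation l j) = R i j" if "i \<in> A" for i j
    using W_apply[OF that, of "\<lambda>l. deviation l j"] deviation_equation[of i j] by (simp add: R_def)
  have "\<exists>G. is_group_inverse A W G"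
  proof (rule group_inverse_exists[OF finite_A, where p=\<pi> and m=m and Z=deviation])
    show "(\<Sum>l\<in>A. W i l) = 0" if "i \<in> A" for i
      using W_apply[OF that, of "\<lambda>_. 1"] by (simp add: Q_sum)
    show "(\<Sum>l\<in>A. \<pi> l * W l j) = 0" if "j \<in> A" for j
      using sum_times_delta(1)[OF finite_A that, of \<pi>]
      by (simp add: W_def mone_def censored_eq_Q right_diff_distrib sum_subtractf of_bool_def pi_Q)
    show "(\<Sum>l\<in>A. W i l * deviation l j) = of_bool (i = j) - m i * \<pi> j" if "i \<in> A" "j \<in> A" for i j
      using that by (simp add: WK R_def N_column_in_A)
    show "v i = v j" if "\<And>i. i \<in> A \<Longrightarrow> (\<Sum>l\<in>A. W i l * v l) = 0" "i \<in> A" "j \<in> A" for v i j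
      by (rule harmonic_constant[OF _ that(2,3)]) (use that(1) W_apply in fastforce)
  qed (rule pi_A_nonzero)
  then have G: "is_group_inverse A W G"
    unfolding G_def using group_inverse_is_group_inverse[OF finite_A] by blast
  have X_A: "X_A A P \<pi> i j = (\<Sum>l\<in>A. G i l * R l j)" for i j
    unfolding X_A_def Let_def W_def[symmetric] G_def[symmetric] mmult_finite[OF finite_A]
    by (intro sum.cong refl) (simp add: first_block_row first_block_row_sum R_def)
  have WX: "(\<Sum>l\<in>A. W i l * X_A A P \<pi> l j) = R i j" if "i \<in> A" for i j
  proof -
    have "X_A A P \<pi> l j = mmult A G (mmult A W deviation) l j" for l
      by (simp add: X_A mmult_finite finite_A WK)
    then have "(\<Sum>l\<in>A. W i l * X_A A P \<pi> l j) = mmult A W (mmult A G (mmult A W deviation)) i j"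
      by (simp add: mmult_finite[OF finite_A, of W])
    also have "\<dots> = mmult A (mmult A (mmult A W G) W) deviation i j"
      by (simp add: mmult_assoc[OF finite_A])
    also have "\<dots> = (\<Sum>l\<in>A. mmult A (mmult A W G) W i l * deviation l j)"
      by (rule mmult_finite[OF finite_A])
    also have "\<dots> = (\<Sum>l\<in>A. W i l * deviation l j)"
      using G that unfolding is_group_inverse_def by (intro sum.cong) auto
    finally show ?thesis by (simp add: WK that)
  qed
  have on_A: "X_A A P \<pi> i j = deviation i j + X_A A P \<pi> \<alpha> j" if "i \<in> A" for i j
  proof -
    have "X_A A P \<pi> i j - deviation i j = X_A A P \<pi> \<alpha> j - deviation \<alpha> j"
    proof (rule harmonic_constant[OF _ that \<alpha>_in_A])
      fix k assume k: "k \<in> A"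
      have "(\<Sum>l\<in>A. W k l * (X_A A P \<pi> l j - deviation l j)) = 0"
        by (simp add: right_diff_distrib sum_subtractf WX WK k)
      then show "X_A A P \<pi> k j - deviation k j = (\<Sum>l\<in>A. Q k l * (X_A A P \<pi> l j - deviation l j))"
        using W_apply[OF k, of "\<lambda>l. X_A A P \<pi> l j - deviation l j"] by simp
    qed
    then show ?thesis by (simp add: deviation_alpha)
  qed
  show ?thesis
  proof (cases "i \<in> A")
    case True
    then show ?thesis using \<alpha>_in_A by (simp add: X_tilde_def on_A[of i])
  next
    case False
    have "X_B A P \<pi> i j = (\<Sum>l\<in>A. Q i l * X_A A P \<pi> l j) + N i j - m i * \<pi> j"
      unfolding X_B_def Let_def second_block_row[OF False] second_block_row_sum[OF False] mmult_finite[OF finite_A]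
      by (simp add: mmult_P_hat_P[OF False])
    also have "(\<Sum>l\<in>A. Q i l * X_A A P \<pi> l j) = (\<Sum>l\<in>A. Q i l * deviation l j + Q i l * X_A A P \<pi> \<alpha> j)"
      by (intro sum.cong refl) (simp add: on_A[of _ j] distrib_left)
    also have "\<dots> = (\<Sum>l\<in>A. Q i l * deviation l j) + X_A A P \<pi> \<alpha> j"
      by (simp add: sum.distrib Q_sum flip: sum_distrib_right)
    finally show ?thesis
      using False \<alpha>_in_A deviation_equation[of i j] by (simp add: X_tilde_def)
  qed
qed

end

section \<open>The deviation over a return cycle\<close>

theorem theorem3p2:
  fixes P :: "'a::countable \<Rightarrow> 'a \<Rightarrow> real"
    and Pr :: "'a \<Rightarrow> 'w measure"
    and \<Phi> :: "nat \<Rightarrow> 'w \<Rightarrow> 'a"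
    and \<pi> \<beta> :: "'a \<Rightarrow> real"
    and A :: "'a set"
    and \<alpha> :: 'a
    and K :: "'a \<Rightarrow> 'a \<Rightarrow> real"
  assumes "markov_chain Pr \<Phi> P"
    and "irreducible_matrix P"
    and "positive_recurrent Pr \<Phi>"
    and "invariant_probability_vector P \<pi>"
    and "finite A" and "A \<noteq> {}"
    and "\<alpha> \<in> A"
    and "\<And>i j. K i j =
           (\<integral>\<omega>. (\<Sum>k | enat k < return_time \<Phi> \<alpha> \<omega>. (of_bool (\<Phi> k \<omega> = j) - \<pi> j)) \<partial>Pr i)"
    and "\<And>j. \<beta> j = X_tilde A P \<pi> \<alpha> j"
  shows "K = (\<lambda>i j. X_tilde A P \<pi> i j - \<beta> j)"
proof -
  interpret markov_process P Pr \<Phi>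
    using assms(1) by unfold_locales (simp_all add: markov_chain_def)
  interpret censoring P A \<alpha> \<pi>
  proof
    show "potential (taboo P (- {\<alpha>})) (\<lambda>_. 1) \<alpha> < \<infinity>"
      using assms(3) unfolding positive_recurrent_def expected_return_time by blast
  qed (use assms in auto)
  have "K i j = deviation i j" for i j
    unfolding assms(8) deviation_def by (rule integral_before_return) (rule V_finite, simp)
  then show ?thesis
    by (intro ext) (simp add: assms(9) deviation_eq_X_tilde)
qed

end
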